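(* Let $\Omega\subset\mathbb{R}^n$ be a bounded Lipschitz polyhedron with trivial de Rham cohomology and let $1\le k\le n$. Set $V^-=H\Lambda^{k-1}(\Omega)$, $V=H\Lambda^{k}(\Omega)$, $W^+=L^2\Lambda^{k+1}(\Omega)$ and define, for $(\sigma,\xi,u),(\tau,\eta,v)\in V^-\times W^+\times V$, \[ B(\sigma,\xi,u;\tau,\eta,v)=(\sigma,\tau)+(\xi,\eta)+(d^{k-1}\sigma,v)+(\xi,d^kv)+(d^{k-1}\tau,u)+(\eta,d^ku). \] Then there exists a constant $C_{\mathrm{cts}}>0$ depending only on $\Omega$ such that \[ \inf_{\substack{(\sigma,\xi,u)\in V^-\times W^+\times V\\ \|\sigma\|_{V^-}^2+\|\xi\|^2+\|u\|_V^2=1}}\ \sup_{\substack{(\tau,\eta,v)\in V^-\times W^+\times V\\ \|\tau\|_{V^-}^2+\|\eta\|^2+\|v\|_V^2=1}} B(\sigma,\xi,u;\tau,\eta,v)\ \ge\ C_{\mathrm{cts}}>0 . \]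
   Context: $L^2\Lambda^j(\Omega)$ is the space of differential $j$-forms on $\Omega$ with $L^2$ coefficients, with inner product $(\cdot,\cdot)$ and norm $\|\cdot\|$; $d^j$ is the (weak) exterior derivative and $H\Lambda^j(\Omega)=\{\omega\in L^2\Lambda^j(\Omega): d^j\omega\in L^2\Lambda^{j+1}(\Omega)\}$. Norms: $\|\tau\|_{V^-}^2=\|\tau\|^2+\|d^{k-1}\tau\|^2$, $\|v\|_V^2=\|v\|^2+\|d^kv\|^2$. Trivial cohomology means in particular that the kernel of $d^j$ on $H\Lambda^j(\Omega)$ equals the range of $d^{j-1}$ for $j\ge1$ (e.g. $\Omega$ contractible). *)

theory Defs
  imports "HOL-Analysis.Analysis"
begin

(* A (measurable) differential form field on a subset of R^n is represented by its
   coefficient function  w :: real^'n => 'n list => real :  w x [i1,...,ik] is the value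
   of the form at x on the basis vectors e_i1,...,e_ik (alternating in the index list).
   A j-form vanishes on index lists of length different from j. *)
type_synonym 'n form = "real^'n \<Rightarrow> 'n list \<Rightarrow> real"

definition alternating_form :: "'n form \<Rightarrow> bool" where
  "alternating_form w \<longleftrightarrow>
     (\<forall>x xs i j. i < length xs \<and> j < length xs \<and> i \<noteq> j \<longrightarrow>
        w x (xs[i := xs ! j, j := xs ! i]) = - w x xs)"

definition L2form :: "nat \<Rightarrow> (real^'n) set \<Rightarrow> 'n form \<Rightarrow> bool" where
  "L2form j \<Omega> w \<longleftrightarrow> alternating_form w \<and>
     (\<forall>x xs. length xs \<noteq> j \<longrightarrow> w x xs = 0) \<and>
     (\<forall>xs. length xs = j \<longrightarrow>
        (\<lambda>x. w x xs) \<in> borel_measurable (lebesgue_on \<Omega>) \<and>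
        integrable (lebesgue_on \<Omega>) (\<lambda>x. (w x xs)\<^sup>2))"

(* L^2 inner product of j-forms: integral of sum over increasing multi-indices
   = (1/j!) * sum over all index lists of length j *)
definition form_inner :: "nat \<Rightarrow> (real^'n) set \<Rightarrow> 'n form \<Rightarrow> 'n form \<Rightarrow> real" where
  "form_inner j \<Omega> w v =
     integral\<^sup>L (lebesgue_on \<Omega>)
       (\<lambda>x. (\<Sum>xs\<in>{xs::'n list. length xs = j}. w x xs * v x xs) / fact j)"

definition form_normsq :: "nat \<Rightarrow> (real^'n) set \<Rightarrow> 'n form \<Rightarrow> real" where
  "form_normsq j \<Omega> w = form_inner j \<Omega> w w"

definition partial :: "'n \<Rightarrow> (real^'n \<Rightarrow> real) \<Rightarrow> real^'n \<Rightarrow> real" where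
  "partial i f x = frechet_derivative f (at x) (axis i 1)"

fun iter_partial :: "'n list \<Rightarrow> (real^'n \<Rightarrow> real) \<Rightarrow> real^'n \<Rightarrow> real" where
  "iter_partial [] f = f"
| "iter_partial (i # is) f = partial i (iter_partial is f)"

definition smooth_fun :: "(real^'n \<Rightarrow> real) \<Rightarrow> bool" where
  "smooth_fun f \<longleftrightarrow> (\<forall>is x. iter_partial is f differentiable (at x))"

definition test_fun :: "(real^'n) set \<Rightarrow> (real^'n \<Rightarrow> real) \<Rightarrow> bool" where
  "test_fun \<Omega> \<phi> \<longleftrightarrow> smooth_fun \<phi> \<and> compact (closure {x. \<phi> x \<noteq> 0}) \<and>
     closure {x. \<phi> x \<noteq> 0} \<subseteq> \<Omega>"

definition remove_nth :: "nat \<Rightarrow> 'a list \<Rightarrow> 'a list" where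
  "remove_nth j xs = take j xs @ drop (Suc j) xs"

(* t is the weak exterior derivative of the j-form w:
   (d w)(e_{i_0},...,e_{i_j}) = sum_m (-1)^m d_{i_m} w(..., omit i_m, ...) in the sense of
   distributions *)
definition weak_d :: "nat \<Rightarrow> (real^'n) set \<Rightarrow> 'n form \<Rightarrow> 'n form \<Rightarrow> bool" where
  "weak_d j \<Omega> w t \<longleftrightarrow>
     (\<forall>\<phi> ys. test_fun \<Omega> \<phi> \<and> length ys = Suc j \<longrightarrow>
        integral\<^sup>L (lebesgue_on \<Omega>) (\<lambda>x. t x ys * \<phi> x) =
        - (\<Sum>m<Suc j. (-1) ^ m *
             integral\<^sup>L (lebesgue_on \<Omega>)
               (\<lambda>x. w x (remove_nth m ys) * partial (ys ! m) \<phi> x)))"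

definition HLambda :: "nat \<Rightarrow> (real^'n) set \<Rightarrow> 'n form set" where
  "HLambda j \<Omega> = {w. L2form j \<Omega> w \<and> (\<exists>t. L2form (Suc j) \<Omega> t \<and> weak_d j \<Omega> w t)}"

(* the weak exterior derivative d^j (unique up to null sets) *)
definition dform :: "nat \<Rightarrow> (real^'n) set \<Rightarrow> 'n form \<Rightarrow> 'n form" where
  "dform j \<Omega> w = (SOME t. L2form (Suc j) \<Omega> t \<and> weak_d j \<Omega> w t)"

definition lipschitz_domain :: "(real^'n) set \<Rightarrow> bool" where
  "lipschitz_domain \<Omega> \<longleftrightarrow> open \<Omega> \<and> bounded \<Omega> \<and> \<Omega> \<noteq> {} \<and>
     (\<forall>p\<in>frontier \<Omega>. \<exists>r>0. \<exists>e L g. norm e = 1 \<and> lipschitz_on L UNIV g \<and>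
        \<Omega> \<inter> ball p r = {x\<in>ball p r. x \<bullet> e < g (x - (x \<bullet> e) *\<^sub>R e)})"

definition lipschitz_polyhedron :: "(real^'n) set \<Rightarrow> bool" where
  "lipschitz_polyhedron \<Omega> \<longleftrightarrow> lipschitz_domain \<Omega> \<and>
     (\<exists>\<T>. finite \<T> \<and> (\<forall>T\<in>\<T>. int CARD('n) simplex T) \<and> closure \<Omega> = \<Union>\<T>)"

(* trivial de Rham cohomology, in the L^2 sense: Omega connected (H^0 = R) and
   ker d^j = range d^(j-1) on H Lambda^j for 1 <= j <= n *)
definition trivial_cohomology :: "(real^'n) set \<Rightarrow> bool" where
  "trivial_cohomology \<Omega> \<longleftrightarrow> connected \<Omega> \<and>
     (\<forall>j. 1 \<le> j \<and> j \<le> CARD('n) \<longrightarrow>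
        (\<forall>w\<in>HLambda j \<Omega>. (AE x in lebesgue_on \<Omega>. dform j \<Omega> w x = (\<lambda>_. 0)) \<longrightarrow>
           (\<exists>s\<in>HLambda (j - 1) \<Omega>. AE x in lebesgue_on \<Omega>. w x = dform (j - 1) \<Omega> s x)))"

definition Bform :: "nat \<Rightarrow> (real^'n) set \<Rightarrow> 'n form \<times> 'n form \<times> 'n form
                       \<Rightarrow> 'n form \<times> 'n form \<times> 'n form \<Rightarrow> real" where
  "Bform k \<Omega> X Y = (case X of (\<sigma>, \<xi>, u) \<Rightarrow> case Y of (\<tau>, \<eta>, v) \<Rightarrow>
      form_inner (k - 1) \<Omega> \<sigma> \<tau> + form_inner (k + 1) \<Omega> \<xi> \<eta>
    + form_inner k \<Omega> (dform (k - 1) \<Omega> \<sigma>) v + form_inner (k + 1) \<Omega> \<xi> (dform k \<Omega> v)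
    + form_inner k \<Omega> (dform (k - 1) \<Omega> \<tau>) u + form_inner (k + 1) \<Omega> \<eta> (dform k \<Omega> u))"

definition unit_triples :: "nat \<Rightarrow> (real^'n) set \<Rightarrow> ('n form \<times> 'n form \<times> 'n form) set" where
  "unit_triples k \<Omega> = {(\<sigma>, \<xi>, u).
      \<sigma> \<in> HLambda (k - 1) \<Omega> \<and> L2form (k + 1) \<Omega> \<xi> \<and> u \<in> HLambda k \<Omega> \<and>
      (form_normsq (k - 1) \<Omega> \<sigma> + form_normsq k \<Omega> (dform (k - 1) \<Omega> \<sigma>))
      + form_normsq (k + 1) \<Omega> \<xi>
      + (form_normsq k \<Omega> u + form_normsq (k + 1) \<Omega> (dform k \<Omega> u)) = 1}"

end

theory Submission
  imports Defs "HOL-Library.Function_Algebras"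
begin

text \<open>Trivial cohomology identifies the range of the weak exterior derivative with the kernel of the
  next one, so it is a complete space, and the open mapping theorem yields a constant \<open>c\<close> such that every
  closed form \<open>z\<close> is \<open>d \<rho>\<close> with \<open>\<parallel>\<rho>\<parallel> \<le> c \<parallel>z\<parallel>\<close>. Hence \<open>u = z + u'\<close> with \<open>d u' = d u\<close>,
  \<open>\<parallel>u'\<parallel> \<le> c \<parallel>d u\<parallel>\<close> and \<open>z = d \<rho>\<close>, \<open>\<parallel>\<rho>\<parallel> \<le> c \<parallel>z\<parallel>\<close>. Testing \<open>B\<close> against \<open>(\<sigma> + e \<rho>, \<xi> + d u, d \<sigma> - u)\<close>
  with \<open>e = 1 / (4 (c\<^sup>2 + 1))\<close> controls all five norms from below. Since \<open>dform\<close> picks an arbitrary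
  weak derivative, its linearity up to null sets rests on the fundamental lemma of the calculus of
  variations.\<close>

section \<open>Smooth functions and box bumps\<close>

text \<open>Forms are plain functions, never classes modulo null sets, so all norms here are
  seminorms and completeness means that absolutely summable series converge. The derivative is
  treated as a relation \<open>weak_d\<close> between representatives, which is linear and closed;
  \<open>dform\<close> is compared with it only up to null sets. The Baire and open mapping
  arguments therefore run for closed linear relations between complete seminormed spaces. The test
  triple needs d d = 0, since d(d \<sigma> - u) = -du only because d \<sigma> is closed; for weak
  derivatives this rests on the symmetry of second partials of test functions. The term with e is
  what controls u: without it B sees only du, whereas d \<rho> = z pairs the closed part z with u.
  The price is cross terms with the factor e c, hence the smallness of e. The case k = n is special
  twice: the cohomology hypothesis stops at degree n, but forms of degree n + 1 vanish; and unit
  triples must then come from top degree forms. Infimum and supremum are real, so nonemptiness and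
  boundedness must be proved.\<close>

lemma smooth_fun_coinduct:
  assumes "f \<in> S" "\<And>g x. g \<in> S \<Longrightarrow> g differentiable (at x)"
    "\<And>g i. g \<in> S \<Longrightarrow> partial i g \<in> S"
  shows "smooth_fun f"
proof -
  have "iter_partial is f \<in> S" for "is"
    by (induction "is") (auto simp: assms)
  then show ?thesis
    using assms(2) by (auto simp: smooth_fun_def)
qed

lemma iter_partial_append:
  "iter_partial (is @ js) f = iter_partial is (iter_partial js f)"
  by (induction "is") auto

lemma smooth_fun_partial: "smooth_fun f \<Longrightarrow> smooth_fun (partial i f)"
  unfolding smooth_fun_def by (metis iter_partial_append iter_partial.simps)

lemma smooth_fun_differentiable: "smooth_fun f \<Longrightarrow> f differentiable (at x)"
  unfolding smooth_fun_def by (metis iter_partial.simps(1))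

lemma smooth_fun_continuous_on: "smooth_fun f \<Longrightarrow> continuous_on A f"
  by (meson continuous_at_imp_continuous_on differentiable_imp_continuous_within smooth_fun_differentiable)

lemma partial_eqI: "(f has_derivative f') (at x) \<Longrightarrow> partial i f x = f' (axis i 1)"
  by (simp add: partial_def frechet_derivative_at[symmetric])

lemma has_derivative_along_axis:
  fixes f :: "real^'n \<Rightarrow> real"
  assumes "\<And>y. f differentiable (at y)"
  shows "((\<lambda>t. f (x + t *\<^sub>R axis i 1)) has_real_derivative partial i f (x + t *\<^sub>R axis i 1)) (at t)"
proof -
  let ?y = "x + t *\<^sub>R axis i 1"
  have f: "(f has_derivative frechet_derivative f (at ?y)) (at ?y)"
    using assms frechet_derivative_works by blast
  have "((\<lambda>t. x + t *\<^sub>R axis i (1::real)) has_derivative (\<lambda>t. t *\<^sub>R axis i 1)) (at t)"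
    by (auto intro!: derivative_eq_intros)
  from diff_chain_at[OF this f]
  have "((\<lambda>t. f (x + t *\<^sub>R axis i 1)) has_derivative
      (\<lambda>t. frechet_derivative f (at ?y) (t *\<^sub>R axis i 1))) (at t)"
    by (simp add: o_def)
  moreover have "frechet_derivative f (at ?y) (t *\<^sub>R axis i 1) = partial i f ?y * t" for t
    using linear_frechet_derivative[OF assms]
    by (simp add: partial_def linear_cmul)
  ultimately show ?thesis
    by (simp add: has_field_derivative_def)
qed

text \<open>The second difference is symmetric in \<open>i\<close> and \<open>j\<close>, while the
  mean value theorem, applied first in direction \<open>i\<close> and then in direction
  \<open>j\<close>, expresses it through one particular order of differentiation.\<close>

lemma second_difference_mvt:
  fixes f :: "real^'n \<Rightarrow> real"
  assumes f: "\<And>y. f differentiable (at y)" and fi: "\<And>y. partial i f differentiable (at y)"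
    and "h > 0"
  shows "\<exists>y. dist y x \<le> 2 * h \<and>
     f (x + h *\<^sub>R axis i 1 + h *\<^sub>R axis j 1) - f (x + h *\<^sub>R axis i 1) - f (x + h *\<^sub>R axis j 1) + f x
       = h * h * partial j (partial i f) y"
proof -
  let ?a = "axis i 1 :: real^'n" and ?b = "axis j 1 :: real^'n"
  define \<phi> where "\<phi> s = f (x + h *\<^sub>R ?b + s *\<^sub>R ?a) - f (x + s *\<^sub>R ?a)" for s
  have "(\<phi> has_real_derivative partial i f (x + h *\<^sub>R ?b + s *\<^sub>R ?a) - partial i f (x + s *\<^sub>R ?a)) (at s)" for s
    unfolding \<phi>_def by (intro DERIV_diff has_derivative_along_axis f)
  with MVT2[of 0 h \<phi> "\<lambda>s. partial i f (x + h *\<^sub>R ?b + s *\<^sub>R ?a) - partial i f (x + s *\<^sub>R ?a)"]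
    \<open>h > 0\<close> obtain s where s: "0 < s" "s < h"
    "\<phi> h - \<phi> 0 = h * (partial i f (x + h *\<^sub>R ?b + s *\<^sub>R ?a) - partial i f (x + s *\<^sub>R ?a))"
    by auto
  from MVT2[of 0 h "\<lambda>t. partial i f (x + s *\<^sub>R ?a + t *\<^sub>R ?b)"
      "\<lambda>t. partial j (partial i f) (x + s *\<^sub>R ?a + t *\<^sub>R ?b)"]
  obtain t where t: "0 < t" "t < h"
    "partial i f (x + s *\<^sub>R ?a + h *\<^sub>R ?b) - partial i f (x + s *\<^sub>R ?a)
      = h * partial j (partial i f) (x + s *\<^sub>R ?a + t *\<^sub>R ?b)"
    using has_derivative_along_axis[OF fi] \<open>h > 0\<close> by force
  have comm: "x + h *\<^sub>R ?b + s *\<^sub>R ?a = x + s *\<^sub>R ?a + h *\<^sub>R ?b" for s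
    by (simp add: algebra_simps)
  have "f (x + h *\<^sub>R ?a + h *\<^sub>R ?b) - f (x + h *\<^sub>R ?a) - f (x + h *\<^sub>R ?b) + f x
       = h * h * partial j (partial i f) (x + s *\<^sub>R ?a + t *\<^sub>R ?b)"
    using s(3) t(3) unfolding \<phi>_def comm by simp
  moreover have "dist (x + s *\<^sub>R ?a + t *\<^sub>R ?b) x \<le> 2 * h"
    using s t norm_triangle_ineq[of "s *\<^sub>R ?a" "t *\<^sub>R ?b"] by (simp add: dist_norm)
  ultimately show ?thesis
    by blast
qed

text \<open>Both orders represent the same second difference at points within \<open>2 * h\<close>
  of \<open>x\<close>; the mixed partials are continuous, so letting \<open>h\<close> tend to 0
  identifies them at \<open>x\<close>.\<close>

lemma partial_commute:
  fixes f :: "real^'n \<Rightarrow> real"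
  assumes f: "smooth_fun f"
  shows "partial i (partial j f) x = partial j (partial i f) x"
proof -
  let ?a = "axis i 1 :: real^'n" and ?b = "axis j 1 :: real^'n"
  have sm: "smooth_fun (partial i f)" "smooth_fun (partial j f)"
    "smooth_fun (partial i (partial j f))" "smooth_fun (partial j (partial i f))"
    using f by (auto intro: smooth_fun_partial)
  define h where "h n = inverse (real (Suc n))" for n
  have h0: "h n > 0" for n by (simp add: h_def)
  have "\<exists>y z. dist y x \<le> 2 * h n \<and> dist z x \<le> 2 * h n \<and>
     partial j (partial i f) y = partial i (partial j f) z" for n
  proof -
    from second_difference_mvt[OF smooth_fun_differentiable[OF f] smooth_fun_differentiable[OF sm(1)] h0[of n], of x j]
    obtain y where 1: "dist y x \<le> 2 * h n"
     "f (x + h n *\<^sub>R ?a + h n *\<^sub>R ?b) - f (x + h n *\<^sub>R ?a) - f (x + h n *\<^sub>R ?b) + f x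
       = h n * h n * partial j (partial i f) y"
      by blast
    from second_difference_mvt[OF smooth_fun_differentiable[OF f] smooth_fun_differentiable[OF sm(2)] h0[of n], of x i]
    obtain z where 2: "dist z x \<le> 2 * h n"
     "f (x + h n *\<^sub>R ?b + h n *\<^sub>R ?a) - f (x + h n *\<^sub>R ?b) - f (x + h n *\<^sub>R ?a) + f x
       = h n * h n * partial i (partial j f) z"
      by blast
    have "f (x + h n *\<^sub>R ?b + h n *\<^sub>R ?a) = f (x + h n *\<^sub>R ?a + h n *\<^sub>R ?b)"
      by (simp add: algebra_simps)
    with 1(2) 2(2) have "h n * h n * partial j (partial i f) y = h n * h n * partial i (partial j f) z"
      by linarith
    then have "partial j (partial i f) y = partial i (partial j f) z"
      using h0[of n] by simp
    with 1(1) 2(1) show ?thesis by blast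
  qed
  then obtain y z where *: "\<And>n. dist (y n) x \<le> 2 * h n" "\<And>n. dist (z n) x \<le> 2 * h n"
    and eq: "\<And>n. partial j (partial i f) (y n) = partial i (partial j f) (z n)"
    by metis
  have "(\<lambda>n. 2 * h n) \<longlonglongrightarrow> 2 * 0"
    unfolding h_def by (intro tendsto_intros LIMSEQ_inverse_real_of_nat)
  then have h: "(\<lambda>n. 2 * h n) \<longlonglongrightarrow> 0" by simp
  have lim: "y \<longlonglongrightarrow> x" "z \<longlonglongrightarrow> x"
    using * by (auto intro!: metric_tendsto_imp_tendsto[OF h] always_eventually simp: less_imp_le[OF h0])
  have cont: "isCont g x" if "smooth_fun g" for g
    using smooth_fun_differentiable[OF that] differentiable_imp_continuous_within by blast
  have "(\<lambda>n. partial j (partial i f) (y n)) \<longlonglongrightarrow> partial j (partial i f) x"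
    by (rule isCont_tendsto_compose[OF cont[OF sm(4)] lim(1)])
  moreover have "(\<lambda>n. partial j (partial i f) (y n)) \<longlonglongrightarrow> partial i (partial j f) x"
    unfolding eq by (rule isCont_tendsto_compose[OF cont[OF sm(3)] lim(2)])
  ultimately show ?thesis
    using LIMSEQ_unique by blast
qed

text \<open>Off its closed support the function vanishes near each point, hence so does its
  derivative. Closure under partials allows the identity defining \<open>weak_d\<close> to be
  applied twice.\<close>

lemma test_fun_partial:
  assumes "test_fun \<Omega> \<phi>"
  shows "test_fun \<Omega> (partial i \<phi>)"
proof -
  have sm: "smooth_fun \<phi>" using assms by (simp add: test_fun_def)
  have "partial i \<phi> x = 0" if x: "x \<notin> closure {x. \<phi> x \<noteq> 0}" for x
  proof -
    have "((\<lambda>_. 0) has_derivative (\<lambda>_. 0)) (at x)" by simp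
    moreover have "open (- closure {x. \<phi> x \<noteq> 0})" by auto
    moreover have "x \<in> - closure {x. \<phi> x \<noteq> 0}" using x by simp
    moreover have "0 = \<phi> y" if "y \<in> - closure {x. \<phi> x \<noteq> 0}" for y
      using that closure_subset[of "{x. \<phi> x \<noteq> 0}"] by auto
    ultimately have "(\<phi> has_derivative (\<lambda>_. 0)) (at x)"
      by (rule has_derivative_transform_within_open)
    from partial_eqI[OF this] show ?thesis .
  qed
  then have "{x. partial i \<phi> x \<noteq> 0} \<subseteq> closure {x. \<phi> x \<noteq> 0}" by blast
  then have "closure {x. partial i \<phi> x \<noteq> 0} \<subseteq> closure {x. \<phi> x \<noteq> 0}"
    by (simp add: closure_minimal)
  moreover from this have "compact (closure {x. partial i \<phi> x \<noteq> 0})"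
    using assms unfolding test_fun_def
    by (metis closed_closure compact_eq_bounded_closed bounded_subset)
  ultimately show ?thesis
    using assms smooth_fun_partial[OF sm] unfolding test_fun_def by blast
qed

lemma test_fun_bounded:
  assumes "test_fun \<Omega> \<phi>"
  obtains B where "\<And>x. \<bar>\<phi> x\<bar> \<le> B"
proof -
  have "compact (\<phi> ` closure {x. \<phi> x \<noteq> 0})"
    using assms smooth_fun_continuous_on unfolding test_fun_def by (blast intro: compact_continuous_image)
  then obtain B where B: "\<And>x. x \<in> closure {x. \<phi> x \<noteq> 0} \<Longrightarrow> \<bar>\<phi> x\<bar> \<le> B"
    by (meson bounded_real compact_imp_bounded imageI)
  have "\<bar>\<phi> x\<bar> \<le> max B 0" for x
    using B[of x] closure_subset[of "{x. \<phi> x \<noteq> 0}"] by (cases "\<phi> x = 0") auto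
  then show ?thesis using that by blast
qed

lemma test_fun_measurable:
  assumes "test_fun \<Omega> \<phi>" 
  shows "\<phi> \<in> borel_measurable (lebesgue_on \<Omega>)"
proof -
  have "\<phi> \<in> borel_measurable lborel"
    using assms smooth_fun_continuous_on[of \<phi> UNIV]
    by (auto simp: test_fun_def intro: borel_measurable_continuous_onI)
  then show ?thesis
    by (metis measurable_completion measurable_restrict_space1)
qed


section \<open>Flat functions and smooth bumps on boxes\<close>

definition flat :: "real \<Rightarrow> nat \<Rightarrow> real \<Rightarrow> real" where
  "flat c k x = (if x > 0 then (1 / x) ^ k * exp (- c / x) else 0)"

text \<open>\<open>flat c 0\<close> is the classical function exp(-c/x) extended by 0. The extra
  powers of 1/x make the linear span of the family closed under differentiation; the delicate point
  is 0, where exponential decay beats every power.\<close>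

lemma flat_has_derivative:
  assumes "c > 0"
  shows "(flat c k has_real_derivative c * flat c (k + 2) x - real k * flat c (k + 1) x) (at x)"
proof -
  consider "x > 0" | "x < 0" | "x = 0" by linarith
  then show ?thesis
  proof cases
    case 1
    have "((\<lambda>x. (1 / x) ^ k * exp (- c / x)) has_real_derivative
        c * flat c (k + 2) x - real k * flat c (k + 1) x) (at x)"
      using 1
      by (cases k, auto intro!: derivative_eq_intros simp: flat_def field_simps power2_eq_square)
        (metis One_nat_def power_eq_if)
    then show ?thesis
      by (rule has_field_derivative_transform_within_open[where S = "{0<..}"])
        (use 1 in \<open>auto simp: flat_def\<close>)
  next
    case 2
    have "((\<lambda>x. 0) has_real_derivative c * flat c (k + 2) x - real k * flat c (k + 1) x) (at x)"
      using 2 by (simp add: flat_def)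
    then show ?thesis
      by (rule has_field_derivative_transform_within_open[where S = "{..<0}"])
        (use 2 in \<open>auto simp: flat_def\<close>)
  next
    case 3
    \<comment> \<open>With y = c/h the right-hand difference quotient at 0 is y^(k+1) / exp y up to
      the factor c^(k+1), and y tends to infinity as h tends to 0.\<close>
    have "((\<lambda>x::real. x ^ (k + 1) / exp x) \<longlongrightarrow> 0) at_top"
      by (rule tendsto_power_div_exp_0)
    moreover have "filterlim (\<lambda>h. c / h) at_top (at_right 0)"
      using filterlim_tendsto_pos_mult_at_top[OF tendsto_const assms filterlim_inverse_at_top_right]
      by (simp add: divide_inverse)
    ultimately have "((\<lambda>h. (c / h) ^ (k + 1) / exp (c / h)) \<longlongrightarrow> 0) (at_right 0)"
      by (rule filterlim_compose)
    then have "((\<lambda>h. (c / h) ^ (k + 1) / exp (c / h) / c ^ (k + 1)) \<longlongrightarrow> 0) (at_right 0)"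
      by (rule tendsto_divide_zero)
    moreover have "eventually (\<lambda>h. (c / h) ^ (k + 1) / exp (c / h) / c ^ (k + 1) = flat c k h / h) (at_right 0)"
      using eventually_at_right_less[of 0]
    proof eventually_elim
      case (elim h)
      then show ?case
        using assms
        by (simp add: flat_def exp_minus divide_inverse power_mult_distrib power_inverse mult_ac)
    qed
    ultimately have R: "((\<lambda>h. flat c k h / h) \<longlongrightarrow> 0) (at_right 0)"
      by (rule Lim_transform_eventually)
    have "eventually (\<lambda>h. 0 = flat c k h / h) (at_left 0)"
      unfolding eventually_at_filter by (auto simp: flat_def)
    with tendsto_const have L: "((\<lambda>h. flat c k h / h) \<longlongrightarrow> 0) (at_left 0)"
      by (rule Lim_transform_eventually)
    from R L have "((\<lambda>h. flat c k h / h) \<longlongrightarrow> 0) (at 0)"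
      by (simp add: filterlim_split_at)
    then show ?thesis
      using 3 by (simp add: DERIV_def flat_def)
  qed
qed

lemma flat_0_nonneg: "flat c 0 x \<ge> 0"
  and flat_0_le_1: "c > 0 \<Longrightarrow> flat c 0 x \<le> 1"
  by (auto simp: flat_def)

lemma flat_0_tendsto: "x > 0 \<Longrightarrow> (\<lambda>n. flat (1 / real (Suc n)) 0 x) \<longlonglongrightarrow> 1"
proof -
  assume "x > 0"
  have "(\<lambda>n. exp (- inverse (real (Suc n)) / x)) \<longlonglongrightarrow> exp (- 0 / x)"
    by (intro tendsto_intros LIMSEQ_inverse_real_of_nat) (use \<open>x > 0\<close> in auto)
  with \<open>x > 0\<close> show ?thesis
    by (simp add: flat_def divide_inverse)
qed

text \<open>An invariant set for \<open>smooth_fun_coinduct\<close>: it contains the bumps, and the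
  product rule keeps partials inside the algebra.\<close>

inductive_set flat_algebra :: "(real^'n \<Rightarrow> real) set" where
  const: "(\<lambda>_. r) \<in> flat_algebra"
| flat: "c > 0 \<Longrightarrow> (\<lambda>x. flat c k (e * x $ i + a)) \<in> flat_algebra"
| add: "f \<in> flat_algebra \<Longrightarrow> g \<in> flat_algebra \<Longrightarrow> (\<lambda>x. f x + g x) \<in> flat_algebra"
| mult: "f \<in> flat_algebra \<Longrightarrow> g \<in> flat_algebra \<Longrightarrow> (\<lambda>x. f x * g x) \<in> flat_algebra"

lemma flat_affine_has_derivative:
  fixes x :: "real^'n"
  assumes "c > 0"
  shows "((\<lambda>x. flat c k (e * x $ i + a)) has_derivative
    (\<lambda>v. (c * flat c (k + 2) (e * x $ i + a) - real k * flat c (k + 1) (e * x $ i + a)) * (e * v $ i))) (at x)"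
proof -
  have "((\<lambda>x. e * x $ i + a) has_derivative (\<lambda>v. e * v $ i)) (at x)"
    by (auto intro!: derivative_eq_intros bounded_linear_imp_has_derivative[OF bounded_linear_vec_nth])
  from has_derivative_compose[OF this, of "flat c k"] flat_has_derivative[OF assms]
  show ?thesis
    by (simp add: has_field_derivative_def)
qed

lemma flat_algebra_differentiable:
  assumes "f \<in> flat_algebra" shows "f differentiable (at x)"
  using assms
proof induction
  case (flat c k e i a)
  then show ?case
    using flat_affine_has_derivative differentiable_def by blast
qed auto

lemma flat_algebra_partial:
  fixes f :: "real^'n \<Rightarrow> real"
  assumes "f \<in> flat_algebra" shows "partial j f \<in> flat_algebra"
  using assms
proof induction
  case (const r)
  have "partial j (\<lambda>_::real^'n. r) = (\<lambda>_. 0)"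
    using partial_eqI[OF has_derivative_const] by blast
  then show ?case by (simp add: flat_algebra.const)
next
  case (flat c k e i a)
  have "partial j (\<lambda>x::real^'n. flat c k (e * x $ i + a)) =
    (\<lambda>x. (e * axis j 1 $ i * c) * flat c (k + 2) (e * x $ i + a)
      + (- (e * axis j 1 $ i * real k)) * flat c (k + 1) (e * x $ i + a))"
    by (intro ext, subst partial_eqI[OF flat_affine_has_derivative[OF flat]])
      (simp add: algebra_simps)
  then show ?case
    by (simp only:) (intro flat_algebra.intros flat)
next
  case (add f g)
  have "partial j (\<lambda>x. f x + g x) = (\<lambda>x. partial j f x + partial j g x)"
    using flat_algebra_differentiable add(1,2)
    by (intro ext partial_eqI[where f' = "\<lambda>v. frechet_derivative f (at _) v + frechet_derivative g (at _) v", folded partial_def])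
      (auto intro!: has_derivative_add simp: frechet_derivative_works[symmetric])
  then show ?case using add by (auto intro: flat_algebra.intros)
next
  case (mult f g)
  have "partial j (\<lambda>x. f x * g x) = (\<lambda>x. f x * partial j g x + partial j f x * g x)"
  proof
    fix x
    have "(f has_derivative frechet_derivative f (at x)) (at x)"
      "(g has_derivative frechet_derivative g (at x)) (at x)"
      using flat_algebra_differentiable mult(1,2) by (auto simp: frechet_derivative_works[symmetric])
    from partial_eqI[OF has_derivative_mult[OF this]]
    show "partial j (\<lambda>x. f x * g x) x = f x * partial j g x + partial j f x * g x"
      by (simp add: partial_def)
  qed
  then show ?case using mult by (auto intro: flat_algebra.intros)
qed

text \<open>The parameter \<open>c\<close> sets the steepness at the faces: as it tends to 0 the
  bumps, bounded by 1, converge pointwise to the indicator of the open box.\<close>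

definition box_bump :: "real \<Rightarrow> real^'n \<Rightarrow> real^'n \<Rightarrow> real^'n \<Rightarrow> real" where
  "box_bump c a b x = (\<Prod>i\<in>UNIV. flat c 0 (x $ i - a $ i) * flat c 0 (b $ i - x $ i))"

lemma smooth_fun_box_bump:
  assumes "c > 0" shows "smooth_fun (box_bump c a b)"
proof (rule smooth_fun_coinduct)
  have prod: "(\<lambda>x. \<Prod>i\<in>I. f i x) \<in> flat_algebra"
    if "finite I" "\<And>i. i \<in> I \<Longrightarrow> f i \<in> flat_algebra" for I and f :: "'n \<Rightarrow> real^'n \<Rightarrow> real"
    using that by (induction I) (auto intro: flat_algebra.intros)
  have "(\<lambda>x. flat c 0 (x $ i - a $ i)) \<in> flat_algebra" "(\<lambda>x. flat c 0 (b $ i - x $ i)) \<in> flat_algebra" for i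
    using flat_algebra.flat[OF assms, of 0 1 i "- a $ i"] flat_algebra.flat[OF assms, of 0 "- 1" i "b $ i"]
    by auto
  then show "box_bump c a b \<in> flat_algebra"
    unfolding box_bump_def[abs_def] by (intro prod flat_algebra.mult) auto
qed (auto intro: flat_algebra_differentiable flat_algebra_partial)

lemma box_bump_nonzero_iff: "box_bump c a b x \<noteq> 0 \<longleftrightarrow> x \<in> box a b"
proof -
  have "flat c 0 y = 0 \<longleftrightarrow> y \<le> 0" for y
    by (auto simp: flat_def)
  then show ?thesis
    by (auto simp: box_bump_def mem_box_cart not_le)
qed

lemma box_bump_nonneg: "box_bump c a b x \<ge> 0"
  unfolding box_bump_def by (intro prod_nonneg ballI mult_nonneg_nonneg flat_0_nonneg)

lemma box_bump_le_1: "c > 0 \<Longrightarrow> box_bump c a b x \<le> 1"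
  unfolding box_bump_def by (intro prod_le_1 conjI mult_nonneg_nonneg mult_le_one flat_0_nonneg flat_0_le_1)

lemma box_bump_tendsto_indicator:
  fixes x :: "real^'n"
  shows "(\<lambda>n. box_bump (1 / real (Suc n)) a b x) \<longlonglongrightarrow> indicator (box a b) x"
proof (cases "x \<in> box a b")
  case True
  have "(\<lambda>n. box_bump (1 / real (Suc n)) a b x) \<longlonglongrightarrow> (\<Prod>i\<in>(UNIV::'n set). 1 * 1)"
    unfolding box_bump_def
    by (intro tendsto_prod tendsto_mult flat_0_tendsto) (use True in \<open>auto simp: mem_box_cart\<close>)
  with True show ?thesis by simp
next
  case False
  then have "box_bump (1 / real (Suc n)) a b x = 0" for n
    using box_bump_nonzero_iff by blast
  with False show ?thesis by simp
qed

lemma test_fun_box_bump: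
  assumes "c > 0" "cbox a b \<subseteq> \<Omega>"
  shows "test_fun \<Omega> (box_bump c a b)"
proof -
  have "closure {x. box_bump c a b x \<noteq> 0} \<subseteq> cbox a b"
    unfolding box_bump_nonzero_iff Collect_mem_eq
    by (rule closure_minimal[OF box_subset_cbox closed_cbox])
  moreover have "bounded {x. box_bump c a b x \<noteq> 0}"
    by (simp add: box_bump_nonzero_iff bounded_box)
  ultimately show ?thesis
    using assms smooth_fun_box_bump by (auto simp: test_fun_def)
qed

section \<open>The fundamental lemma of the calculus of variations\<close>

text \<open>Boxes form an intersection-stable generator of the Borel sets, so a Dynkin argument
  extends vanishing integrals from boxes to all Borel sets, and densities are unique almost
  everywhere.\<close>

lemma AE_zero_if_integral_box_zero:
  fixes g :: "'a::euclidean_space \<Rightarrow> real"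
  assumes g: "integrable lborel g"
    and box: "\<And>a b. (LINT x:box a b|lborel. g x) = 0"
  shows "AE x in lborel. g x = 0"
proof -
  let ?G = "range (\<lambda>(a, b). box a b :: 'a set)"
  have sb: "sets borel = sigma_sets UNIV ?G"
    by (subst borel_eq_box) (simp add: sets_measure_of)
  have int: "set_integrable lborel A g" if "A \<in> sets borel" for A
    using that integrable_mult_indicator[OF _ g, of A] by (simp add: set_integrable_def)
  \<comment> \<open>Complements in the Dynkin argument require the total integral, obtained from
    boxes that exhaust the space.\<close>
  have UNIV: "(LINT x:UNIV|lborel. g x) = 0"
  proof -
    let ?B = "\<lambda>i::nat. box (- (real i *\<^sub>R One)) (real i *\<^sub>R One) :: 'a set"
    have "mono ?B"
      by (intro monoI subset_box_imp) auto
    have "(\<lambda>i. LINT x:?B i|lborel. g x) \<longlonglongrightarrow> (LINT x:(\<Union>i. ?B i)|lborel. g x)"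
      by (rule set_integral_cont_up) (use \<open>mono ?B\<close> int in auto)
    then show ?thesis
      using LIMSEQ_unique[OF _ tendsto_const] unfolding box UN_box_eq_UNIV by blast
  qed
  have "(LINT x:A|lborel. g x) = 0" if "A \<in> sets borel" for A
  proof -
    have "Int_stable ?G" by (auto simp: Int_stable_def box_Int_box)
    moreover have "?G \<subseteq> Pow UNIV" by simp
    moreover have "A \<in> sigma_sets UNIV ?G"
      using that sb by simp
    ultimately show ?thesis
    proof (induction rule: sigma_sets_induct_disjoint)
      case (basic A)
      then show ?case using box by auto
    next
      case empty
      then show ?case by (simp add: set_lebesgue_integral_def)
    next
      case (compl A)
      then have A: "A \<in> sets borel" using sb by simp
      have "(LINT x:A \<union> (UNIV - A)|lborel. g x) = (LINT x:A|lborel. g x) + (LINT x:UNIV - A|lborel. g x)"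
        using A by (intro set_integral_Un int) auto
      then show ?case using UNIV compl by (simp add: Un_UNIV_right)
    next
      case (union A)
      then have A: "A i \<in> sets borel" for i using sb by auto
      have "(LINT x:(\<Union>i. A i)|lborel. g x) = (\<Sum>i. (LINT x:(A i)|lborel. g x))"
        using A union(1) by (intro lebesgue_integral_countable_add int) (auto simp: disjoint_family_on_def)
      then show ?case using union by simp
    qed
  qed
  then show ?thesis
    by (intro density_unique_real[OF g, of "\<lambda>_. 0"]) (auto simp: set_lebesgue_integral_def)
qed

lemma AE_zero_if_orthogonal_to_test_funs:
  fixes \<Omega> :: "(real^'n) set"
  assumes \<Omega>: "open \<Omega>" and t: "integrable (lebesgue_on \<Omega>) t"
    and ortho: "\<And>\<phi>. test_fun \<Omega> \<phi> \<Longrightarrow> integral\<^sup>L (lebesgue_on \<Omega>) (\<lambda>x. t x * \<phi> x) = 0"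
  shows "AE x in lebesgue_on \<Omega>. t x = 0"
proof -
  have meas: "\<Omega> \<in> sets lebesgue" "\<Omega> \<inter> space lebesgue \<in> sets lebesgue"
    using \<Omega> by auto
  define f where "f x = indicator \<Omega> x * t x" for x
  have f: "integrable lebesgue f"
    using t unfolding integrable_restrict_space[OF meas(2)] f_def by simp
  \<comment> \<open>\<open>t\<close> is only Lebesgue measurable, whereas the box criterion is about
    \<open>lborel\<close>; hence a Borel representative.\<close>
  then obtain g where g: "g \<in> borel_measurable lborel" and fg: "AE x in lborel. f x = g x"
    using completion_ex_borel_measurable_real[of f lborel] by auto
  have fg': "AE x in lebesgue. f x = g x"
    using fg by (rule AE_completion)
  have "integrable lebesgue g"
    using integrable_cong_AE_imp[OF f] fg' g
    by (metis (mono_tags, lifting) AE_mp AE_I2 measurable_completion)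
  then have gint: "integrable lborel g"
    using integrable_completion[of g lborel] g by simp
  have box0: "(LINT x:box a b|lborel. g x) = 0" if ab: "cbox a b \<subseteq> \<Omega>" for a b
  proof -
    have "(LINT x:box a b|lborel. g x) = (LINT x|lebesgue. indicator (box a b) x *\<^sub>R g x)"
      unfolding set_lebesgue_integral_def
      by (rule integral_completion[symmetric]) (use g in measurable)
    also have "\<dots> = (LINT x|lebesgue. indicator (box a b) x *\<^sub>R f x)"
    proof (rule integral_cong_AE)
      show "(\<lambda>x. indicat_real (box a b) x *\<^sub>R g x) \<in> borel_measurable lebesgue"
        by (rule measurable_completion) (use g in measurable)
      show "(\<lambda>x. indicat_real (box a b) x *\<^sub>R f x) \<in> borel_measurable lebesgue"
        using f by (intro borel_measurable_scaleR borel_measurable_indicator) auto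
    qed (use fg' in auto)
    also have "(\<lambda>n. LINT x|lebesgue. box_bump (1 / real (Suc n)) a b x * f x)
        \<longlonglongrightarrow> (LINT x|lebesgue. indicator (box a b) x *\<^sub>R f x)"
    proof (rule integral_dominated_convergence)
      show "integrable lebesgue (\<lambda>x. norm (f x))" using f by simp
      show "AE x in lebesgue. (\<lambda>n. box_bump (1 / real (Suc n)) a b x * f x) \<longlonglongrightarrow> indicat_real (box a b) x *\<^sub>R f x"
        by (simp add: tendsto_mult_right box_bump_tendsto_indicator del: of_nat_Suc)
      show "AE x in lebesgue. norm (box_bump (1 / real (Suc n)) a b x * f x) \<le> norm (f x)" for n
        using box_bump_nonneg[of "1 / real (Suc n)" a b] box_bump_le_1[of "1 / real (Suc n)" a b]
        by (auto simp: abs_mult mult_left_le_one_le simp del: of_nat_Suc)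
      show "(\<lambda>x. indicat_real (box a b) x *\<^sub>R f x) \<in> borel_measurable lebesgue"
        using f by (intro borel_measurable_scaleR borel_measurable_indicator) auto
      fix n
      have "continuous_on UNIV (box_bump (1 / real (Suc n)) a b)"
        by (intro smooth_fun_continuous_on smooth_fun_box_bump) simp
      then have "box_bump (1 / real (Suc n)) a b \<in> borel_measurable lborel"
        by (auto intro: borel_measurable_continuous_onI)
      then have "box_bump (1 / real (Suc n)) a b \<in> borel_measurable lebesgue"
        by (rule measurable_completion)
      then show "(\<lambda>x. box_bump (1 / real (Suc n)) a b x * f x) \<in> borel_measurable lebesgue"
        using f by (intro borel_measurable_times) auto
    qed
    then have "(LINT x|lebesgue. indicator (box a b) x *\<^sub>R f x) = 0"
    proof (rule LIMSEQ_unique)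
      have "(LINT x|lebesgue. box_bump (1 / real (Suc n)) a b x * f x) = 0" for n
        using ortho[OF test_fun_box_bump[OF _ ab, of "1 / real (Suc n)"]]
        unfolding integral_restrict_space[OF meas(2)] f_def by (simp add: mult_ac)
      then show "(\<lambda>n. LINT x|lebesgue. box_bump (1 / real (Suc n)) a b x * f x) \<longlonglongrightarrow> 0"
        by simp
    qed
    finally show ?thesis .
  qed
  have cbox0: "AE x in lborel. x \<in> cbox a b \<longrightarrow> g x = 0" if ab: "cbox a b \<subseteq> \<Omega>" for a b
  proof -
    have "AE x in lborel. indicator (box a b) x * g x = 0"
    proof (rule AE_zero_if_integral_box_zero)
      show "integrable lborel (\<lambda>x. indicat_real (box a b) x * g x)"
        using integrable_mult_indicator[OF _ gint, of "box a b"] by simp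
      fix c d
      \<comment> \<open>Cutting off by the box turns any other box into a box inside it, over which
        the integral is already known to vanish.\<close>
      obtain p q where pq: "box c d \<inter> box a b = box p q"
        unfolding box_Int_box by blast
      have "(LINT x:box c d|lborel. indicat_real (box a b) x * g x) = (LINT x:box p q|lborel. g x)"
        unfolding set_lebesgue_integral_def pq[symmetric] indicator_inter_arith by (simp add: mult_ac)
      also have "\<dots> = 0"
      proof (cases "box p q = {}")
        case False
        then have "cbox p q = closure (box p q)" by (simp add: closure_box)
        also have "\<dots> \<subseteq> cbox a b"
          by (rule closure_minimal) (use pq box_subset_cbox in auto)
        finally show ?thesis using box0 ab by blast
      qed (simp add: set_lebesgue_integral_def)
      finally show "(LINT x:box c d|lborel. indicat_real (box a b) x * g x) = 0" .
    qed
    moreover have "AE x in lborel. x \<notin> cbox a b - box a b"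
      using negligible_frontier_interval[of a b] negligible_iff_null_sets
      by (metis (no_types) AE_completion_iff AE_not_in)
    ultimately show ?thesis
      by eventually_elim (auto simp: indicator_def split: if_splits)
  qed
  obtain \<D> where \<D>: "countable \<D>" "\<And>X. X \<in> \<D> \<Longrightarrow> X \<subseteq> \<Omega> \<and> (\<exists>a b. X = cbox a b)" "\<Union>\<D> = \<Omega>"
    using open_countable_Union_open_cbox[OF \<Omega>] by (metis Pow_iff subsetD)
  have "AE x in lborel. \<forall>X\<in>\<D>. x \<in> X \<longrightarrow> g x = 0"
    by (intro AE_ball_countable' \<D>(1)) (use \<D>(2) cbox0 in blast)
  with fg have "AE x in lborel. x \<in> \<Omega> \<longrightarrow> t x = 0"
    by eventually_elim (use \<D>(3) in \<open>auto simp: f_def indicator_def split: if_splits\<close>)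
  then show ?thesis
    unfolding AE_restrict_space_iff[OF meas(2)] by (rule AE_completion)
qed

section \<open>Semi-inner products and completeness of L2\<close>

text \<open>Pointwise scaling makes forms, being curried functions, a real vector space, so that
  \<open>subspace\<close> and its rules apply to them directly.\<close>

instantiation "fun" :: (type, scaleR) scaleR
begin

definition scaleR_fun_def: "r *\<^sub>R f = (\<lambda>x. r *\<^sub>R f x)"

instance ..

end

lemma scaleR_fun_apply [simp]: "(r *\<^sub>R f) x = r *\<^sub>R f x"
  by (simp add: scaleR_fun_def)

instance "fun" :: (type, real_vector) real_vector
  by standard (simp_all add: fun_eq_iff scaleR_add_left scaleR_add_right)

lemma sum_fun_apply: "(\<Sum>i\<in>I. f i) x = (\<Sum>i\<in>I. f i x)"
  by (induction I rule: infinite_finite_induct) auto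

text \<open>Only semi-definite, because functions that agree almost everywhere are not identified;
  relative to a carrier, because additivity of the integral needs integrable products.\<close>

locale semi_inner_space =
  fixes V :: "'a::real_vector set" and ip :: "'a \<Rightarrow> 'a \<Rightarrow> real"
  assumes V: "subspace V"
    and ip_commute: "\<And>x y. x \<in> V \<Longrightarrow> y \<in> V \<Longrightarrow> ip x y = ip y x"
    and ip_add_left: "\<And>x y z. x \<in> V \<Longrightarrow> y \<in> V \<Longrightarrow> z \<in> V \<Longrightarrow> ip (x + y) z = ip x z + ip y z"
    and ip_scaleR_left: "\<And>r x y. x \<in> V \<Longrightarrow> y \<in> V \<Longrightarrow> ip (r *\<^sub>R x) y = r * ip x y"
    and ip_nonneg: "\<And>x. x \<in> V \<Longrightarrow> ip x x \<ge> 0"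
begin

definition nrm :: "'a \<Rightarrow> real" where "nrm x = sqrt (ip x x)"

lemma closed_add: "x \<in> V \<Longrightarrow> y \<in> V \<Longrightarrow> x + y \<in> V"
  and closed_scaleR: "x \<in> V \<Longrightarrow> r *\<^sub>R x \<in> V"
  and closed_diff: "x \<in> V \<Longrightarrow> y \<in> V \<Longrightarrow> x - y \<in> V"
  and closed_sum: "(\<And>i. i \<in> I \<Longrightarrow> f i \<in> V) \<Longrightarrow> sum f I \<in> V"
  and closed_zero: "0 \<in> V"
  using V by (auto intro: subspace_add subspace_scale subspace_diff subspace_sum subspace_0)

lemma ip_add_right: "x \<in> V \<Longrightarrow> y \<in> V \<Longrightarrow> z \<in> V \<Longrightarrow> ip z (x + y) = ip z x + ip z y"
  by (metis closed_add ip_add_left ip_commute)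

lemma ip_scaleR_right: "x \<in> V \<Longrightarrow> y \<in> V \<Longrightarrow> ip x (r *\<^sub>R y) = r * ip x y"
  by (metis closed_scaleR ip_scaleR_left ip_commute)

lemma ip_diff_left: "x \<in> V \<Longrightarrow> y \<in> V \<Longrightarrow> z \<in> V \<Longrightarrow> ip (x - y) z = ip x z - ip y z"
  using ip_add_left[of x "(-1) *\<^sub>R y" z] ip_scaleR_left[of y z "-1"] closed_scaleR[of y "-1"] by simp

lemma ip_diff_right: "x \<in> V \<Longrightarrow> y \<in> V \<Longrightarrow> z \<in> V \<Longrightarrow> ip z (x - y) = ip z x - ip z y"
  by (metis closed_diff ip_diff_left ip_commute)

lemmas ip_simps = ip_add_left ip_add_right ip_diff_left ip_diff_right ip_scaleR_left ip_scaleR_right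
  closed_add closed_diff closed_scaleR

lemma nrm_power2: "x \<in> V \<Longrightarrow> (nrm x)\<^sup>2 = ip x x"
  by (simp add: nrm_def ip_nonneg)

lemma nrm_nonneg: "x \<in> V \<Longrightarrow> nrm x \<ge> 0"
  by (simp add: nrm_def ip_nonneg)

lemma cauchy_schwarz:
  assumes x: "x \<in> V" and y: "y \<in> V"
  shows "\<bar>ip x y\<bar> \<le> nrm x * nrm y"
proof -
  have "(ip x y)\<^sup>2 \<le> ip x x * ip y y"
  proof (cases "ip y y = 0")
    case True
    have "ip x y = 0"
    proof (rule ccontr)
      assume c: "ip x y \<noteq> 0"
      \<comment> \<open>When \<open>ip y y = 0\<close> the square of \<open>x - s y\<close> is
        affine in s, with slope given by \<open>ip x y\<close>; this s makes it -1.\<close>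
      let ?s = "(ip x x + 1) / (2 * ip x y)"
      have "0 \<le> ip (x - ?s *\<^sub>R y) (x - ?s *\<^sub>R y)"
        using x y by (intro ip_nonneg closed_diff closed_scaleR)
      also have "\<dots> = ip x x - 2 * ?s * ip x y"
        using x y True by (simp add: ip_simps ip_commute[of y x])
      also have "\<dots> = -1" using c by (simp add: field_simps)
      finally show False by simp
    qed
    with True show ?thesis by simp
  next
    case False
    then have pos: "ip y y > 0" using ip_nonneg[OF y] by simp
    have "0 \<le> ip (ip y y *\<^sub>R x - ip x y *\<^sub>R y) (ip y y *\<^sub>R x - ip x y *\<^sub>R y)"
      using x y by (intro ip_nonneg closed_diff closed_scaleR)
    also have "\<dots> = ip y y * (ip x x * ip y y - (ip x y)\<^sup>2)"
      using x y by (simp add: ip_simps ip_commute[of y x] algebra_simps power2_eq_square)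
    finally show ?thesis
      using pos by (simp add: zero_le_mult_iff)
  qed
  then have "sqrt ((ip x y)\<^sup>2) \<le> sqrt (ip x x * ip y y)"
    by (rule real_sqrt_le_mono)
  then show ?thesis by (simp add: nrm_def real_sqrt_mult)
qed

lemma nrm_triangle:
  assumes x: "x \<in> V" and y: "y \<in> V"
  shows "nrm (x + y) \<le> nrm x + nrm y"
proof (rule power2_le_imp_le)
  have "ip x y \<le> nrm x * nrm y" using cauchy_schwarz[OF x y] by simp
  then show "(nrm (x + y))\<^sup>2 \<le> (nrm x + nrm y)\<^sup>2"
    using x y nrm_power2[OF x] nrm_power2[OF y] 
    by (simp add: nrm_power2 ip_simps ip_commute[of y x] power2_sum)
  show "0 \<le> nrm x + nrm y" using x y nrm_nonneg by simp
qed

lemma nrm_scaleR: "x \<in> V \<Longrightarrow> nrm (r *\<^sub>R x) = \<bar>r\<bar> * nrm x"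
  by (simp add: nrm_def ip_simps real_sqrt_mult flip: mult.assoc)

lemma nrm_zero: "nrm 0 = 0"
  using nrm_scaleR[OF closed_zero, of 0] by simp

lemma nrm_sum: "(\<And>i. i \<in> I \<Longrightarrow> f i \<in> V) \<Longrightarrow> nrm (sum f I) \<le> (\<Sum>i\<in>I. nrm (f i))"
proof (induction I rule: infinite_finite_induct)
  case (insert i I)
  then have "nrm (f i + sum f I) \<le> nrm (f i) + nrm (sum f I)"
    by (intro nrm_triangle closed_sum) auto
  with insert show ?case by force
qed (auto simp: nrm_zero)

end

section \<open>Square integrable functions and their completeness\<close>

definition L2_fun :: "'a measure \<Rightarrow> ('a \<Rightarrow> real) set" where
  "L2_fun M = {f. f \<in> borel_measurable M \<and> integrable M (\<lambda>x. (f x)\<^sup>2)}"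

definition L2_ip :: "'a measure \<Rightarrow> ('a \<Rightarrow> real) \<Rightarrow> ('a \<Rightarrow> real) \<Rightarrow> real" where
  "L2_ip M f g = (\<integral>x. f x * g x \<partial>M)"

lemma L2_fun_D: 
  assumes "f \<in> L2_fun M"
  shows "f \<in> borel_measurable M" "integrable M (\<lambda>x. (f x)\<^sup>2)"
  using assms by (auto simp: L2_fun_def)

lemma L2_fun_bound:
  assumes "g \<in> borel_measurable M" "integrable M h" "AE x in M. (g x)\<^sup>2 \<le> h x"
  shows "g \<in> L2_fun M"
proof -
  have "integrable M (\<lambda>x. (g x)\<^sup>2)"
  proof (rule Bochner_Integration.integrable_bound[OF assms(2)])
    show "AE x in M. norm ((g x)\<^sup>2) \<le> norm (h x)"
      using assms(3) by eventually_elim auto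
  qed (use assms(1) in measurable)
  with assms(1) show ?thesis by (simp add: L2_fun_def)
qed

lemma L2_fun_cong_AE:
  assumes f: "f \<in> L2_fun M" and g: "g \<in> borel_measurable M" and ae: "AE x in M. f x = g x"
  shows "g \<in> L2_fun M"
  by (rule L2_fun_bound[OF g L2_fun_D(2)[OF f]]) (use ae in auto)

lemma L2_ip_cong_AE:
  assumes "f \<in> L2_fun M" "f' \<in> L2_fun M" "g \<in> L2_fun M" "AE x in M. f x = f' x"
  shows "L2_ip M f g = L2_ip M f' g"
  unfolding L2_ip_def
proof (rule integral_cong_AE)
  show "(\<lambda>x. f x * g x) \<in> borel_measurable M" "(\<lambda>x. f' x * g x) \<in> borel_measurable M"
    using assms by (simp_all add: borel_measurable_times L2_fun_D(1))
  show "AE x in M. f x * g x = f' x * g x"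
    using assms(4) by eventually_elim simp
qed

lemma L2_fun_mult_integrable:
  assumes f: "f \<in> L2_fun M" and g: "g \<in> L2_fun M"
  shows "integrable M (\<lambda>x. f x * g x)"
proof (rule Bochner_Integration.integrable_bound)
  show "integrable M (\<lambda>x. (f x)\<^sup>2 + (g x)\<^sup>2)"
    using L2_fun_D[OF f] L2_fun_D[OF g] by simp
  show "(\<lambda>x. f x * g x) \<in> borel_measurable M"
    using L2_fun_D(1)[OF f] L2_fun_D(1)[OF g] by (rule borel_measurable_times)
  have "\<bar>a * b\<bar> \<le> a\<^sup>2 + b\<^sup>2" for a b :: real
  proof -
    have "2 * \<bar>a * b\<bar> \<le> a\<^sup>2 + b\<^sup>2"
      using sum_squares_bound[of "\<bar>a\<bar>" "\<bar>b\<bar>"] by (simp add: abs_mult)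
    then show ?thesis using abs_ge_zero[of "a * b"] by linarith
  qed
  then show "AE x in M. norm (f x * g x) \<le> norm ((f x)\<^sup>2 + (g x)\<^sup>2)"
    by simp
qed

lemma subspace_L2_fun: "subspace (L2_fun M)"
proof (rule subspaceI)
  show "0 \<in> L2_fun M" by (simp add: L2_fun_def zero_fun_def)
  fix f g assume fg: "f \<in> L2_fun M" "g \<in> L2_fun M"
  show "f + g \<in> L2_fun M"
  proof (rule L2_fun_bound[where h = "\<lambda>x. 2 * (f x)\<^sup>2 + 2 * (g x)\<^sup>2"])
    show "f + g \<in> borel_measurable M"
      unfolding plus_fun_def using fg[THEN L2_fun_D(1)] by (rule borel_measurable_add)
    have "(a + b)\<^sup>2 \<le> 2 * a\<^sup>2 + 2 * b\<^sup>2" for a b :: real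
      using sum_squares_bound[of a b] by (simp add: power2_sum)
    then show "AE x in M. ((f + g) x)\<^sup>2 \<le> 2 * (f x)\<^sup>2 + 2 * (g x)\<^sup>2" by simp
    show "integrable M (\<lambda>x. 2 * (f x)\<^sup>2 + 2 * (g x)\<^sup>2)"
      using fg[THEN L2_fun_D(2)] by simp
  qed
next
  fix c f assume f: "f \<in> L2_fun M"
  then show "c *\<^sub>R f \<in> L2_fun M"
    by (auto simp: L2_fun_def scaleR_fun_def power_mult_distrib)
qed

interpretation L2: semi_inner_space "L2_fun M" "L2_ip M" for M
proof
  fix f g h :: "'a \<Rightarrow> real" and r assume "f \<in> L2_fun M" "g \<in> L2_fun M"
  show "L2_ip M f g = L2_ip M g f"
    by (simp add: L2_ip_def mult.commute)
  show "L2_ip M (r *\<^sub>R f) g = r * L2_ip M f g" "L2_ip M f f \<ge> 0"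
    by (simp_all add: L2_ip_def mult.assoc)
  assume "h \<in> L2_fun M"
  with \<open>f \<in> L2_fun M\<close> \<open>g \<in> L2_fun M\<close> show "L2_ip M (f + g) h = L2_ip M f h + L2_ip M g h"
    by (simp add: L2_ip_def distrib_right L2_fun_mult_integrable)
qed (rule subspace_L2_fun)

lemma L2_ip_self: "L2_ip M f f = (\<integral>x. (f x)\<^sup>2 \<partial>M)"
  by (simp add: L2_ip_def power2_eq_square)

lemma L2_nrm_cong_AE:
  assumes "f \<in> L2_fun M" "g \<in> L2_fun M" "AE x in M. f x = g x"
  shows "L2.nrm M f = L2.nrm M g"
proof -
  have "L2_ip M f f = L2_ip M g f" "L2_ip M f g = L2_ip M g g"
    using assms by (auto intro: L2_ip_cong_AE)
  with L2.ip_commute[OF assms(1,2)] show ?thesis by (simp add: L2.nrm_def)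
qed

lemma L2_fun_abs: "f \<in> L2_fun M \<Longrightarrow> (\<lambda>x. \<bar>f x\<bar>) \<in> L2_fun M"
  and L2_nrm_abs: "L2.nrm M (\<lambda>x. \<bar>f x\<bar>) = L2.nrm M f"
  by (auto simp: L2_fun_def L2.nrm_def L2_ip_self)

text \<open>Riesz-Fischer for series. The partial sums of absolute values have norm at most
  \<open>C\<close>, so by monotone convergence their limit is finite almost everywhere and square
  integrable; it then dominates all tails.\<close>

lemma L2_fun_series:
  assumes f: "\<And>n. f n \<in> L2_fun M" and sf: "summable (\<lambda>n. L2.nrm M (f n))"
  shows "AE x in M. summable (\<lambda>n. f n x)"
    and "(\<lambda>x. \<Sum>n. f n x) \<in> L2_fun M"
    and "(\<lambda>N. L2.nrm M ((\<lambda>x. \<Sum>n. f n x) - (\<Sum>n<N. f n))) \<longlonglongrightarrow> 0"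
proof -
  define C where "C = (\<Sum>n. L2.nrm M (f n))"
  define S where "S N = (\<Sum>n<N. (\<lambda>x. \<bar>f n x\<bar>))" for N
  have S_apply: "S N x = (\<Sum>n<N. \<bar>f n x\<bar>)" for N x
    by (simp add: S_def sum_fun_apply)
  have S: "S N \<in> L2_fun M" for N
    unfolding S_def by (intro L2.closed_sum L2_fun_abs f)
  have S0: "S N x \<ge> 0" for N x by (simp add: S_apply sum_nonneg)
  have "L2.nrm M (S N) \<le> C" for N
  proof -
    have "L2.nrm M (S N) \<le> (\<Sum>n<N. L2.nrm M (\<lambda>x. \<bar>f n x\<bar>))"
      unfolding S_def by (intro L2.nrm_sum L2_fun_abs f)
    also have "\<dots> \<le> C"
      unfolding C_def L2_nrm_abs by (intro sum_le_suminf sf) (use f L2.nrm_nonneg in auto)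
    finally show ?thesis .
  qed
  then have SC: "(\<integral>x. (S N x)\<^sup>2 \<partial>M) \<le> C\<^sup>2" for N
    using L2.nrm_power2[OF S, of N] L2.nrm_nonneg[OF S, of N] unfolding L2_ip_self
    by (metis power_mono)
  have meas: "f n \<in> borel_measurable M" for n using f L2_fun_D by blast
  note [measurable] = meas L2_fun_D(1)[OF S]
  have mono: "incseq (\<lambda>N x. ennreal ((S N x)\<^sup>2))"
    using S0 by (auto simp: incseq_def le_fun_def S_apply intro!: ennreal_leI power_mono sum_mono2)
  have SUP_le: "(\<integral>\<^sup>+x. (SUP N. ennreal ((S N x)\<^sup>2)) \<partial>M) \<le> ennreal (C\<^sup>2)"
  proof -
    have "(\<integral>\<^sup>+x. (SUP N. ennreal ((S N x)\<^sup>2)) \<partial>M) = (SUP N. \<integral>\<^sup>+x. ennreal ((S N x)\<^sup>2) \<partial>M)"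
      by (rule nn_integral_monotone_convergence_SUP[OF mono]) measurable
    also have "\<dots> \<le> ennreal (C\<^sup>2)"
      using SC by (intro SUP_least) (simp add: nn_integral_eq_integral L2_fun_D[OF S] ennreal_leI)
    finally show ?thesis .
  qed
  have "(\<integral>\<^sup>+x. (SUP N. ennreal ((S N x)\<^sup>2)) \<partial>M) \<noteq> \<infinity>"
    unfolding infinity_ennreal_def by (rule neq_top_trans[OF ennreal_neq_top SUP_le])
  then have "AE x in M. (SUP N. ennreal ((S N x)\<^sup>2)) \<noteq> \<infinity>"
    by (rule nn_integral_PInf_AE[rotated]) measurable
  then have ae: "AE x in M. summable (\<lambda>n. \<bar>f n x\<bar>)"
  proof eventually_elim
    case (elim x)
    then obtain B where B: "(SUP N. ennreal ((S N x)\<^sup>2)) = ennreal B" "B \<ge> 0"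
      by (cases "SUP N. ennreal ((S N x)\<^sup>2)") auto
    have "(\<Sum>n<N. \<bar>f n x\<bar>) \<le> sqrt B" for N
    proof -
      have "ennreal ((S N x)\<^sup>2) \<le> ennreal B" unfolding B(1)[symmetric] by (rule SUP_upper) simp
      then show ?thesis using B(2) by (simp add: S_apply real_le_rsqrt)
    qed
    then show ?case by (intro summableI_nonneg_bounded) auto
  qed
  then show "AE x in M. summable (\<lambda>n. f n x)"
    by eventually_elim (rule summable_rabs_cancel)
  define G where "G x = (\<Sum>n. \<bar>f n x\<bar>)" for x
  have Gm[measurable]: "G \<in> borel_measurable M"
    unfolding G_def by measurable
  have GS: "AE x in M. ennreal ((G x)\<^sup>2) = (SUP N. ennreal ((S N x)\<^sup>2))"
    using ae
  proof eventually_elim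
    case (elim x)
    then have "(\<lambda>N. S N x) \<longlonglongrightarrow> G x"
      unfolding G_def S_apply by (rule summable_LIMSEQ)
    then have "(\<lambda>N. ennreal ((S N x)\<^sup>2)) \<longlonglongrightarrow> ennreal ((G x)\<^sup>2)"
      by (intro tendsto_ennrealI tendsto_power)
    moreover have "incseq (\<lambda>N. ennreal ((S N x)\<^sup>2))"
      using mono by (auto simp: incseq_def le_fun_def)
    ultimately show ?case
      using LIMSEQ_SUP LIMSEQ_unique by blast
  qed
  have G2: "integrable M (\<lambda>x. (G x)\<^sup>2)"
  proof (rule integrableI_bounded)
    have "(\<integral>\<^sup>+x. ennreal (norm ((G x)\<^sup>2)) \<partial>M) = (\<integral>\<^sup>+x. (SUP N. ennreal ((S N x)\<^sup>2)) \<partial>M)"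
      using GS by (intro nn_integral_cong_AE) auto
    also have "\<dots> < \<infinity>" using SUP_le by (simp add: order_le_less_trans)
    finally show "(\<integral>\<^sup>+x. ennreal (norm ((G x)\<^sup>2)) \<partial>M) < \<infinity>" .
  qed measurable
  define F where "F x = (\<Sum>n. f n x)" for x
  have [measurable]: "F \<in> borel_measurable M"
    unfolding F_def by measurable
  \<comment> \<open>One bound serves twice: at \<open>N = 0\<close> it puts the sum into L2, and for
    general \<open>N\<close> it is the majorant for dominated convergence.\<close>
  have tail: "(F x - (\<Sum>n<N. f n x))\<^sup>2 \<le> (G x)\<^sup>2" if "summable (\<lambda>n. \<bar>f n x\<bar>)" for x N
  proof -
    have s: "summable (\<lambda>n. f n x)" using that by (rule summable_rabs_cancel)
    have "F x - (\<Sum>n<N. f n x) = (\<Sum>n. f (n + N) x)"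
      using suminf_split_initial_segment[OF s, of N] by (simp add: F_def)
    also have "\<bar>\<dots>\<bar> \<le> (\<Sum>n. \<bar>f (n + N) x\<bar>)"
      by (rule summable_rabs[OF summable_ignore_initial_segment[OF that]])
    also have "\<dots> \<le> G x"
      using suminf_split_initial_segment[OF that, of N] by (simp add: G_def sum_nonneg)
    finally have "\<bar>F x - (\<Sum>n<N. f n x)\<bar> \<le> G x" .
    from power_mono[OF this abs_ge_zero, of 2] show ?thesis by simp
  qed
  have "F \<in> L2_fun M"
  proof (rule L2_fun_bound[OF _ G2])
    show "AE x in M. (F x)\<^sup>2 \<le> (G x)\<^sup>2"
      using ae by eventually_elim (use tail[of _ 0] in simp)
  qed measurable
  then show "(\<lambda>x. \<Sum>n. f n x) \<in> L2_fun M" by (simp add: F_def[abs_def])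
  have "(\<lambda>N. \<integral>x. (F x - (\<Sum>n<N. f n x))\<^sup>2 \<partial>M) \<longlonglongrightarrow> (\<integral>x. 0 \<partial>M)"
  proof (rule integral_dominated_convergence[OF _ _ G2])
    show "AE x in M. norm ((F x - (\<Sum>n<N. f n x))\<^sup>2) \<le> (G x)\<^sup>2" for N
      using ae
    proof eventually_elim
      case (elim x)
      from tail[OF this, of N] show ?case by simp
    qed
    show "AE x in M. (\<lambda>N. (F x - (\<Sum>n<N. f n x))\<^sup>2) \<longlonglongrightarrow> 0"
      using ae
    proof eventually_elim
      case (elim x)
      have "(\<lambda>N. \<Sum>n<N. f n x) \<longlonglongrightarrow> F x"
        unfolding F_def by (rule summable_LIMSEQ[OF summable_rabs_cancel[OF elim]])
      then have "(\<lambda>N. (F x - (\<Sum>n<N. f n x))\<^sup>2) \<longlonglongrightarrow> (F x - F x)\<^sup>2"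
        by (intro tendsto_power tendsto_diff tendsto_const)
      then show ?case by simp
    qed
  qed measurable
  then have "(\<lambda>N. sqrt (\<integral>x. (F x - (\<Sum>n<N. f n x))\<^sup>2 \<partial>M)) \<longlonglongrightarrow> sqrt 0"
    by (intro tendsto_real_sqrt) simp
  then show "(\<lambda>N. L2.nrm M ((\<lambda>x. \<Sum>n. f n x) - (\<Sum>n<N. f n))) \<longlonglongrightarrow> 0"
    by (simp add: L2.nrm_def L2_ip_self sum_fun_apply F_def)
qed

section \<open>Differential forms and the weak exterior derivative\<close>

definition L2_forms :: "nat \<Rightarrow> (real^'n) set \<Rightarrow> 'n form set" where
  "L2_forms j \<Omega> = {w. L2form j \<Omega> w}"

abbreviation component :: "'n list \<Rightarrow> 'n form \<Rightarrow> real^'n \<Rightarrow> real" where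
  "component xs w \<equiv> (\<lambda>x. w x xs)"

lemma finite_lists_length: "finite {xs::'n::finite list. length xs = j}"
  using finite_lists_length_eq[of "UNIV :: 'n set" j] by simp

text \<open>Components at index lists of the wrong length are 0 and hence square integrable, so the
  last clause can do without a length condition.\<close>

lemma L2_forms_iff:
  "w \<in> L2_forms j \<Omega> \<longleftrightarrow> alternating_form w \<and> (\<forall>x xs. length xs \<noteq> j \<longrightarrow> w x xs = 0) \<and>
     (\<forall>xs. component xs w \<in> L2_fun (lebesgue_on \<Omega>))"
proof -
  have "component xs w \<in> L2_fun (lebesgue_on \<Omega>)"
    if "\<forall>x xs. length xs \<noteq> j \<longrightarrow> w x xs = 0" "length xs \<noteq> j" for xs
    using that by (simp add: L2_fun_def)
  moreover have "component xs w \<in> L2_fun (lebesgue_on \<Omega>) \<longleftrightarrow>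
    component xs w \<in> borel_measurable (lebesgue_on \<Omega>) \<and> integrable (lebesgue_on \<Omega>) (\<lambda>x. (w x xs)\<^sup>2)" for xs
    by (simp add: L2_fun_def)
  ultimately show ?thesis
    unfolding L2_forms_def L2form_def mem_Collect_eq by metis
qed

lemma L2_forms_component: "w \<in> L2_forms j \<Omega> \<Longrightarrow> component xs w \<in> L2_fun (lebesgue_on \<Omega>)"
  by (simp add: L2_forms_iff)

lemma component_simps:
  "component xs (w + v) = component xs w + component xs v"
  "component xs (w - v) = component xs w - component xs v"
  "component xs (r *\<^sub>R w) = r *\<^sub>R component xs w"
  "component xs 0 = 0"
  by (simp_all add: fun_eq_iff)

lemma subspace_L2_forms: "subspace (L2_forms j \<Omega>)"
proof (rule subspaceI)
  show "0 \<in> L2_forms j \<Omega>"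
    by (simp add: L2_forms_iff alternating_form_def L2.closed_zero[unfolded zero_fun_def])
qed (auto simp: L2_forms_iff alternating_form_def L2.closed_add[unfolded plus_fun_def]
    L2.closed_scaleR[unfolded scaleR_fun_def real_scaleR_def])

lemma form_inner_eq_sum:
  assumes "w \<in> L2_forms j \<Omega>" "v \<in> L2_forms j \<Omega>"
  shows "form_inner j \<Omega> w v =
    (\<Sum>xs | length xs = j. L2_ip (lebesgue_on \<Omega>) (component xs w) (component xs v)) / fact j"
  unfolding form_inner_def L2_ip_def
  by (simp add: Bochner_Integration.integral_sum L2_fun_mult_integrable L2_forms_component[OF assms(1)]
      L2_forms_component[OF assms(2)])

interpretation LF: semi_inner_space "L2_forms j \<Omega>" "form_inner j \<Omega>" for j and \<Omega> :: "(real^'n) set"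
proof
  fix u v w :: "'n form" and r assume u: "u \<in> L2_forms j \<Omega>" and v: "v \<in> L2_forms j \<Omega>"
  note c = L2_forms_component[OF u] L2_forms_component[OF v]
  show "form_inner j \<Omega> u v = form_inner j \<Omega> v u"
    by (simp add: form_inner_def mult.commute)
  show "form_inner j \<Omega> u u \<ge> 0"
    using u c by (simp add: form_inner_eq_sum sum_nonneg L2.ip_nonneg)
  have ru: "r *\<^sub>R u \<in> L2_forms j \<Omega>" using u subspace_L2_forms subspace_scale by blast
  show "form_inner j \<Omega> (r *\<^sub>R u) v = r * form_inner j \<Omega> u v"
    unfolding form_inner_eq_sum[OF ru v] form_inner_eq_sum[OF u v] component_simps
    using c by (simp add: L2.ip_scaleR_left sum_distrib_left)
  assume w: "w \<in> L2_forms j \<Omega>"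
  have uv: "u + v \<in> L2_forms j \<Omega>" using u v subspace_L2_forms subspace_add by blast
  show "form_inner j \<Omega> (u + v) w = form_inner j \<Omega> u w + form_inner j \<Omega> v w"
    unfolding form_inner_eq_sum[OF uv w] form_inner_eq_sum[OF u w] form_inner_eq_sum[OF v w] component_simps
    using c L2_forms_component[OF w] by (simp add: L2.ip_add_left sum.distrib add_divide_distrib)
qed (rule subspace_L2_forms)

lemma nrm_power2_eq_sum:
  assumes "w \<in> L2_forms j \<Omega>"
  shows "(LF.nrm j \<Omega> w)\<^sup>2 = (\<Sum>xs | length xs = j. (L2.nrm (lebesgue_on \<Omega>) (component xs w))\<^sup>2) / fact j"
  using assms by (simp add: LF.nrm_power2 form_inner_eq_sum L2.nrm_power2 L2_forms_component)

lemma component_nrm_le: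
  assumes w: "w \<in> L2_forms j \<Omega>"
  shows "L2.nrm (lebesgue_on \<Omega>) (component xs w) \<le> sqrt (fact j) * LF.nrm j \<Omega> w"
proof (cases "length xs = j")
  case True
  have "(L2.nrm (lebesgue_on \<Omega>) (component xs w))\<^sup>2
      \<le> (\<Sum>xs | length xs = j. (L2.nrm (lebesgue_on \<Omega>) (component xs w))\<^sup>2)"
    using True by (intro member_le_sum finite_lists_length) auto
  also have "\<dots> = (sqrt (fact j) * LF.nrm j \<Omega> w)\<^sup>2"
    using w by (simp add: power_mult_distrib nrm_power2_eq_sum)
  finally show ?thesis
    by (rule power2_le_imp_le) (simp add: LF.nrm_nonneg w)
next
  case False
  then have "component xs w = 0" using w by (auto simp: L2_forms_iff fun_eq_iff)
  then show ?thesis using w by (simp add: L2.nrm_zero LF.nrm_nonneg)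
qed

lemma component_tendsto:
  assumes "\<And>n. W n \<in> L2_forms j \<Omega>" "(\<lambda>n. LF.nrm j \<Omega> (W n)) \<longlonglongrightarrow> 0"
  shows "(\<lambda>n. L2.nrm (lebesgue_on \<Omega>) (component xs (W n))) \<longlonglongrightarrow> 0"
proof (rule tendsto_sandwich[OF _ _ tendsto_const])
  show "(\<lambda>n. sqrt (fact j) * LF.nrm j \<Omega> (W n)) \<longlonglongrightarrow> 0"
    using tendsto_mult_right_zero[OF assms(2)] .
  show "\<forall>\<^sub>F n in sequentially. 0 \<le> L2.nrm (lebesgue_on \<Omega>) (component xs (W n))"
    by (intro always_eventually allI L2.nrm_nonneg L2_forms_component[OF assms(1)])
  show "\<forall>\<^sub>F n in sequentially. L2.nrm (lebesgue_on \<Omega>) (component xs (W n)) \<le> sqrt (fact j) * LF.nrm j \<Omega> (W n)"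
    by (intro always_eventually allI component_nrm_le assms(1))
qed

lemma nrm_tendsto_if_components:
  assumes W: "\<And>n. W n \<in> L2_forms j \<Omega>"
    and c: "\<And>xs. length xs = j \<Longrightarrow> (\<lambda>n. L2.nrm (lebesgue_on \<Omega>) (component xs (W n))) \<longlonglongrightarrow> 0"
  shows "(\<lambda>n. LF.nrm j \<Omega> (W n)) \<longlonglongrightarrow> 0"
proof -
  have "(\<lambda>n. (LF.nrm j \<Omega> (W n))\<^sup>2) \<longlonglongrightarrow> (\<Sum>xs::'a list | length xs = j. 0\<^sup>2) / fact j"
    unfolding nrm_power2_eq_sum[OF W] by (intro tendsto_intros c) auto
  then have "(\<lambda>n. sqrt ((LF.nrm j \<Omega> (W n))\<^sup>2)) \<longlonglongrightarrow> sqrt 0"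
    by (intro tendsto_real_sqrt) simp
  then show ?thesis using LF.nrm_nonneg[OF W] by simp
qed

text \<open>Completeness is inherited from the components, whose norms are at most
  \<open>sqrt (fact j)\<close> times the form norm. Index lists of length \<open>j\<close> are
  finite in number, so one null set carries all exceptional points.\<close>

lemma L2_forms_series:
  fixes \<Omega> :: "(real^'n) set"
  assumes W: "\<And>n. W n \<in> L2_forms j \<Omega>" and s: "summable (\<lambda>n. LF.nrm j \<Omega> (W n))"
  shows "\<exists>w\<in>L2_forms j \<Omega>. (\<lambda>N. LF.nrm j \<Omega> (w - (\<Sum>n<N. W n))) \<longlonglongrightarrow> 0"
proof -
  let ?M = "lebesgue_on \<Omega>"
  have sc: "summable (\<lambda>n. L2.nrm ?M (component xs (W n)))" for xs
    by (rule summable_comparison_test'[OF summable_mult[OF s, of "sqrt (fact j)"], of 0])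
      (use component_nrm_le[OF W] L2.nrm_nonneg[OF L2_forms_component[OF W]] in auto)
  note ser = L2_fun_series[OF L2_forms_component[OF W] sc]
  have "AE x in ?M. \<forall>xs\<in>{xs. length xs = j}. summable (\<lambda>n. W n x xs)"
    by (intro AE_ball_countable' ser(1) countable_finite finite_lists_length)
  then obtain N where N: "N \<in> null_sets ?M"
    "{x\<in>space ?M. \<not> (\<forall>xs\<in>{xs. length xs = j}. summable (\<lambda>n. W n x xs))} \<subseteq> N"
    unfolding eventually_ae_filter by blast
  have W0: "W n x xs = 0" if "length xs \<noteq> j" for n x xs
    using W[of n] that by (auto simp: L2_forms_iff)
  have good: "summable (\<lambda>n. W n x xs)" if "x \<in> space ?M - N" for x xs
    using that N(2) W0[of xs] by (cases "length xs = j") auto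
  \<comment> \<open>Alternation is required at every point, so the sum is replaced by zero where it may diverge.\<close>
  define w where "w x xs = (if x \<in> space ?M - N then \<Sum>n. W n x xs else 0)" for x xs
  have ae: "AE x in ?M. (\<Sum>n. W n x xs) = w x xs" for xs
    using AE_not_in[OF N(1)] AE_space by eventually_elim (simp add: w_def)
  have meas: "component xs w \<in> borel_measurable ?M" for xs
    unfolding w_def
  proof (rule measurable_If)
    show "(\<lambda>x. \<Sum>n. W n x xs) \<in> borel_measurable ?M"
      using ser(2) by (rule L2_fun_D)
    have "space ?M - N \<in> sets ?M" using N(1) by auto
    then show "{x \<in> space ?M. x \<in> space ?M - N} \<in> sets ?M" 
      by (rule back_subst[where P = "\<lambda>A. A \<in> sets ?M"]) auto
  qed auto
  have L2w: "component xs w \<in> L2_fun ?M" for xs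
    by (rule L2_fun_cong_AE[OF ser(2) meas ae])
  have "alternating_form w"
    unfolding alternating_form_def
  proof (intro allI impI)
    fix x i k and xs :: "'n list" assume ik: "i < length xs \<and> k < length xs \<and> i \<noteq> k"
    have "W n x (xs[i := xs ! k, k := xs ! i]) = - W n x xs" for n
      using W[of n] ik by (simp add: L2_forms_iff alternating_form_def)
    then show "w x (xs[i := xs ! k, k := xs ! i]) = - w x xs"
      using good[of x xs] by (simp add: w_def suminf_minus)
  qed
  then have w: "w \<in> L2_forms j \<Omega>"
    using L2w W0 by (auto simp: L2_forms_iff w_def)
  have diff: "w - (\<Sum>n<N. W n) \<in> L2_forms j \<Omega>" for N
    by (intro LF.closed_diff LF.closed_sum w W)
  have "(\<lambda>N. LF.nrm j \<Omega> (w - (\<Sum>n<N. W n))) \<longlonglongrightarrow> 0"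
  proof (rule nrm_tendsto_if_components[OF diff])
    fix xs :: "'n list"
    have eqN: "L2.nrm ?M ((\<lambda>x. \<Sum>n. W n x xs) - (\<Sum>n<N. component xs (W n)))
      = L2.nrm ?M (component xs (w - (\<Sum>n<N. W n)))" for N
    proof -
      have 1: "(\<lambda>x. \<Sum>n. W n x xs) - (\<Sum>n<N. component xs (W n)) \<in> L2_fun ?M"
        by (intro L2.closed_diff ser(2) L2.closed_sum L2_forms_component[OF W])
      have 2: "component xs (w - (\<Sum>n<N. W n)) \<in> L2_fun ?M"
        using diff by (rule L2_forms_component)
      have eq: "AE x in ?M. ((\<lambda>x. \<Sum>n. W n x xs) - (\<Sum>n<N. component xs (W n))) x = component xs (w - (\<Sum>n<N. W n)) x"
        using ae by eventually_elim (simp add: sum_fun_apply)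
      show ?thesis by (rule L2_nrm_cong_AE[OF 1 2 eq])
    qed
    show "(\<lambda>N. L2.nrm ?M (component xs (w - (\<Sum>n<N. W n)))) \<longlonglongrightarrow> 0"
      using ser(3)[of xs] unfolding eqN .
  qed
  with w show ?thesis by blast
qed

lemma form_inner_cong_AE:
  assumes w: "w \<in> L2_forms j \<Omega>" "w' \<in> L2_forms j \<Omega>" "v \<in> L2_forms j \<Omega>"
    and ae: "AE x in lebesgue_on \<Omega>. w x = w' x"
  shows "form_inner j \<Omega> w v = form_inner j \<Omega> w' v"
proof -
  have "AE x in lebesgue_on \<Omega>. component xs w x = component xs w' x" for xs
    using ae by eventually_elim simp
  then show ?thesis
    using w L2_forms_component by (auto simp: form_inner_eq_sum intro!: sum.cong L2_ip_cong_AE)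
qed

lemma length_remove_nth: "m < length xs \<Longrightarrow> length (remove_nth m xs) = length xs - 1"
  by (simp add: remove_nth_def)

lemma nth_remove_nth:
  assumes "m < length xs" "i < length xs - 1"
  shows "remove_nth m xs ! i = (if i < m then xs ! i else xs ! Suc i)"
  using assms by (auto simp: remove_nth_def nth_append min_def)

text \<open>The face identity of simplicial boundaries: once position \<open>m\<close> is gone, the
  old position \<open>Suc l\<close> is found at \<open>l\<close>. It matches the terms that cancel
  in d d.\<close>

lemma remove_nth_remove_nth:
  assumes "m \<le> l" "Suc l < length ys"
  shows "remove_nth l (remove_nth m ys) = remove_nth m (remove_nth (Suc l) ys)"
  using assms by (intro nth_equalityI) (auto simp: length_remove_nth nth_remove_nth)

section \<open>The weak exterior derivative as a closed linear relation\<close>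

locale bounded_open =
  fixes \<Omega> :: "(real^'n) set"
  assumes open_domain: "open \<Omega>" and bounded_domain: "bounded \<Omega>"
begin

abbreviation "M \<equiv> lebesgue_on \<Omega>"

lemma finite_measure_M: "finite_measure M"
  by (intro finite_measure_lebesgue_on lmeasurable_open open_domain bounded_domain)

lemma test_fun_L2_fun: "test_fun \<Omega> \<phi> \<Longrightarrow> \<phi> \<in> L2_fun M"
proof -
  assume t: "test_fun \<Omega> \<phi>"
  obtain B where B: "\<And>x. \<bar>\<phi> x\<bar> \<le> B" using test_fun_bounded[OF t] by blast
  have "(\<phi> x)\<^sup>2 \<le> B\<^sup>2" for x
    using B[of x] power_mono[of "\<bar>\<phi> x\<bar>" B 2] by simp
  then show ?thesis
    by (intro L2_fun_bound[where h = "\<lambda>_. B\<^sup>2"] test_fun_measurable t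
        finite_measure.integrable_const finite_measure_M) auto
qed

text \<open>Read as L2 inner products with test functions, the defining identity is linear by the
  semi-inner product rules and passes to limits by Cauchy-Schwarz.\<close>

lemma weak_d_iff:
  "weak_d j \<Omega> w t \<longleftrightarrow> (\<forall>\<phi> ys. test_fun \<Omega> \<phi> \<longrightarrow> length ys = Suc j \<longrightarrow>
     L2_ip M (component ys t) \<phi> =
     - (\<Sum>m<Suc j. (-1) ^ m * L2_ip M (component (remove_nth m ys) w) (partial (ys ! m) \<phi>)))"
  by (auto simp: weak_d_def L2_ip_def)

lemma weak_d_add:
  assumes "w \<in> L2_forms j \<Omega>" "w' \<in> L2_forms j \<Omega>" "t \<in> L2_forms (Suc j) \<Omega>" "t' \<in> L2_forms (Suc j) \<Omega>"
    and "weak_d j \<Omega> w t" "weak_d j \<Omega> w' t'"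
  shows "weak_d j \<Omega> (w + w') (t + t')"
  using assms unfolding weak_d_iff component_simps
  by (simp add: L2.ip_add_left L2_forms_component test_fun_L2_fun test_fun_partial distrib_left sum.distrib
      del: sum.lessThan_Suc)

lemma weak_d_scaleR:
  assumes "w \<in> L2_forms j \<Omega>" "t \<in> L2_forms (Suc j) \<Omega>" "weak_d j \<Omega> w t"
  shows "weak_d j \<Omega> (r *\<^sub>R w) (r *\<^sub>R t)"
  using assms unfolding weak_d_iff component_simps
  by (simp add: L2.ip_scaleR_left L2_forms_component test_fun_L2_fun test_fun_partial sum_distrib_left mult_ac
      del: sum.lessThan_Suc)

lemma weak_d_zero: "weak_d j \<Omega> 0 0"
  by (simp add: weak_d_def)

lemma weak_d_cong_AE:
  assumes "t \<in> L2_forms (Suc j) \<Omega>" "t' \<in> L2_forms (Suc j) \<Omega>" "AE x in M. t x = t' x" "weak_d j \<Omega> w t"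
  shows "weak_d j \<Omega> w t'"
proof -
  have "L2_ip M (component ys t) \<phi> = L2_ip M (component ys t') \<phi>" if "test_fun \<Omega> \<phi>" for \<phi> ys
  proof (rule L2_ip_cong_AE[OF L2_forms_component[OF assms(1)] L2_forms_component[OF assms(2)]
      test_fun_L2_fun[OF that]])
    show "AE x in M. component ys t x = component ys t' x"
      using assms(3) by eventually_elim simp
  qed
  then show ?thesis using assms(4) unfolding weak_d_iff by simp
qed

text \<open>In each component the difference of two candidates is orthogonal to every test function,
  so the fundamental lemma applies; there are finitely many components.\<close>

lemma weak_d_unique:
  assumes t: "t \<in> L2_forms (Suc j) \<Omega>" "t' \<in> L2_forms (Suc j) \<Omega>"
    and d: "weak_d j \<Omega> w t" "weak_d j \<Omega> w t'"
  shows "AE x in M. t x = t' x"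
proof -
  \<comment> \<open>The domain has finite measure, so pairing with 1 turns square integrability into
    the integrability that the fundamental lemma asks for.\<close>
  have one: "(\<lambda>_. 1) \<in> L2_fun M"
    by (simp add: L2_fun_def finite_measure.integrable_const[OF finite_measure_M])
  have *: "AE x in M. (component ys t - component ys t') x = 0" if len: "length ys = Suc j" for ys
  proof (rule AE_zero_if_orthogonal_to_test_funs[OF open_domain])
    have L: "component ys t - component ys t' \<in> L2_fun M"
      by (rule L2.closed_diff[OF t[THEN L2_forms_component]])
    show "integrable M (component ys t - component ys t')"
      using L2_fun_mult_integrable[OF L one] by (simp add: fun_diff_def)
    show "(\<integral>x. (component ys t - component ys t') x * \<phi> x \<partial>M) = 0" if "test_fun \<Omega> \<phi>" for \<phi>
    proof -
      have "L2_ip M (component ys t - component ys t') \<phi> = L2_ip M (component ys t) \<phi> - L2_ip M (component ys t') \<phi>"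
        by (rule L2.ip_diff_left[OF t[THEN L2_forms_component] test_fun_L2_fun[OF that]])
      also have "\<dots> = 0"
        using d that len unfolding weak_d_iff by simp
      finally show ?thesis by (simp add: L2_ip_def)
    qed
  qed
  have "AE x in M. \<forall>ys\<in>{ys. length ys = Suc j}. (component ys t - component ys t') x = 0"
    by (intro AE_ball_countable' * countable_finite finite_lists_length) simp
  then show ?thesis
  proof eventually_elim
    case (elim x)
    show ?case
    proof
      fix ys show "t x ys = t' x ys"
        using elim t by (cases "length ys = Suc j") (auto simp: L2_forms_iff)
    qed
  qed
qed

lemma L2_ip_tendsto:
  assumes f: "\<And>n. f n \<in> L2_fun M" "g \<in> L2_fun M" "(\<lambda>n. L2.nrm M (g - f n)) \<longlonglongrightarrow> 0" and h: "h \<in> L2_fun M"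
  shows "(\<lambda>n. L2_ip M (f n) h) \<longlonglongrightarrow> L2_ip M g h"
proof -
  have "(\<lambda>n. L2_ip M (f n) h - L2_ip M g h) \<longlonglongrightarrow> 0"
  proof (rule Lim_null_comparison)
    show "(\<lambda>n. L2.nrm M (g - f n) * L2.nrm M h) \<longlonglongrightarrow> 0"
      by (rule tendsto_mult_left_zero[OF f(3)])
    have "\<bar>L2_ip M (f n) h - L2_ip M g h\<bar> \<le> L2.nrm M (g - f n) * L2.nrm M h" for n
      using L2.cauchy_schwarz[OF L2.closed_diff[OF f(2) f(1)] h, of n]
      unfolding L2.ip_diff_left[OF f(2) f(1) h] by linarith
    then show "\<forall>\<^sub>F n in sequentially. norm (L2_ip M (f n) h - L2_ip M g h) \<le> L2.nrm M (g - f n) * L2.nrm M h"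
      by simp
  qed
  then show ?thesis by (rule LIM_zero_cancel)
qed

text \<open>For a fixed test function both sides of the weak identity are continuous in the L2 norms
  of the two forms, so the graph of d is closed.\<close>

lemma weak_d_closed:
  assumes W: "\<And>n. W n \<in> L2_forms j \<Omega>" "w \<in> L2_forms j \<Omega>" "(\<lambda>n. LF.nrm j \<Omega> (w - W n)) \<longlonglongrightarrow> 0"
    and T: "\<And>n. T n \<in> L2_forms (Suc j) \<Omega>" "t \<in> L2_forms (Suc j) \<Omega>" "(\<lambda>n. LF.nrm (Suc j) \<Omega> (t - T n)) \<longlonglongrightarrow> 0"
    and d: "\<And>n. weak_d j \<Omega> (W n) (T n)"
  shows "weak_d j \<Omega> w t"
  unfolding weak_d_iff
proof (intro allI impI)
  fix \<phi> and ys :: "'n list" assume \<phi>: "test_fun \<Omega> \<phi>" and len: "length ys = Suc j"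
  have cW: "(\<lambda>n. L2_ip M (component xs (W n)) \<psi>) \<longlonglongrightarrow> L2_ip M (component xs w) \<psi>" if "test_fun \<Omega> \<psi>" for xs \<psi>
    using component_tendsto[OF LF.closed_diff[OF W(2,1)] W(3), of xs] unfolding component_simps
    by (rule L2_ip_tendsto[OF L2_forms_component[OF W(1)] L2_forms_component[OF W(2)] _ test_fun_L2_fun[OF that]])
  have cT: "(\<lambda>n. L2_ip M (component ys (T n)) \<phi>) \<longlonglongrightarrow> L2_ip M (component ys t) \<phi>"
    using component_tendsto[OF LF.closed_diff[OF T(2,1)] T(3), of ys] unfolding component_simps
    by (rule L2_ip_tendsto[OF L2_forms_component[OF T(1)] L2_forms_component[OF T(2)] _ test_fun_L2_fun[OF \<phi>]])
  have "(\<lambda>n. - (\<Sum>m<Suc j. (-1) ^ m * L2_ip M (component (remove_nth m ys) (W n)) (partial (ys ! m) \<phi>)))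
     \<longlonglongrightarrow> - (\<Sum>m<Suc j. (-1) ^ m * L2_ip M (component (remove_nth m ys) w) (partial (ys ! m) \<phi>))"
    by (intro tendsto_minus tendsto_sum tendsto_mult tendsto_const cW test_fun_partial \<phi>)
  moreover have "L2_ip M (component ys (T n)) \<phi> =
     - (\<Sum>m<Suc j. (-1) ^ m * L2_ip M (component (remove_nth m ys) (W n)) (partial (ys ! m) \<phi>))" for n
    using d[of n] \<phi> len unfolding weak_d_iff by blast
  ultimately show "L2_ip M (component ys t) \<phi> =
     - (\<Sum>m<Suc j. (-1) ^ m * L2_ip M (component (remove_nth m ys) w) (partial (ys ! m) \<phi>))"
    using cT LIMSEQ_unique by (metis (no_types, lifting) ext)
qed

text \<open>Testing twice gives a double sum over pairs of omitted positions. Each pair occurs in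
  both orders with opposite signs, and second partials of the test function commute.\<close>

lemma weak_d_weak_d:
  assumes d: "weak_d j \<Omega> w t"
  shows "weak_d (Suc j) \<Omega> t 0"
  unfolding weak_d_iff
proof (intro allI impI)
  fix \<phi> and ys :: "'n list" assume \<phi>: "test_fun \<Omega> \<phi>" and len: "length ys = Suc (Suc j)"
  define F where "F = (\<lambda>(m, l). (-1) ^ (m + l) *
    L2_ip M (component (remove_nth l (remove_nth m ys)) w) (partial (remove_nth m ys ! l) (partial (ys ! m) \<phi>)))"
  let ?A = "{..<Suc (Suc j)} \<times> {..<Suc j}"
  let ?P = "{(m, l). m \<le> l \<and> l < Suc j}" and ?Q = "{(m, l). l < m \<and> m < Suc (Suc j)}"
  have A: "?A = ?P \<union> ?Q" "?P \<inter> ?Q = {}" by auto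
  have fin: "finite ?P" "finite ?Q"
    by (rule finite_subset[of _ ?A]; auto)+
  have "(\<Sum>m<Suc (Suc j). (-1) ^ m * L2_ip M (component (remove_nth m ys) t) (partial (ys ! m) \<phi>))
    = (\<Sum>m<Suc (Suc j). - (\<Sum>l<Suc j. F (m, l)))"
  proof (rule sum.cong[OF refl])
    fix m assume "m \<in> {..<Suc (Suc j)}"
    then have "length (remove_nth m ys) = Suc j" using len by (simp add: length_remove_nth)
    then have "L2_ip M (component (remove_nth m ys) t) (partial (ys ! m) \<phi>) =
      - (\<Sum>l<Suc j. (-1) ^ l * L2_ip M (component (remove_nth l (remove_nth m ys)) w)
          (partial (remove_nth m ys ! l) (partial (ys ! m) \<phi>)))"
      using d test_fun_partial[OF \<phi>] unfolding weak_d_iff by blast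
    then show "(-1) ^ m * L2_ip M (component (remove_nth m ys) t) (partial (ys ! m) \<phi>) = - (\<Sum>l<Suc j. F (m, l))"
      by (simp add: F_def power_add sum_distrib_left mult.assoc del: sum.lessThan_Suc)
  qed
  also have "\<dots> = - (\<Sum>p\<in>?A. F p)"
    by (simp only: sum_negf sum.cartesian_product case_prod_eta)
  also have "(\<Sum>p\<in>?A. F p) = (\<Sum>p\<in>?P. F p) + (\<Sum>p\<in>?Q. F p)"
    unfolding A(1) by (rule sum.union_disjoint[OF fin A(2)])
  also have "(\<Sum>p\<in>?Q. F p) = (\<Sum>p\<in>?P. - F p)"
  \<comment> \<open>Omitting the original positions \<open>l < m\<close> is encoded as
    \<open>(m, l)\<close> when \<open>m\<close> goes first, and as \<open>(l, m - 1)\<close> when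
    \<open>l\<close> goes first, because its removal shifts \<open>m\<close> down. That shift by one
    is also the change of sign.\<close>
  proof (rule sum.reindex_bij_witness[where i = "\<lambda>(m, l). (Suc l, m)" and j = "\<lambda>(m, l). (l, m - 1)"])
    fix p assume "p \<in> ?Q"
    then obtain m l where p: "p = (Suc m, l)" and lm: "l \<le> m" "m < Suc j"
      by (cases p, cases "fst p") auto
    have nth: "remove_nth (Suc m) ys ! l = ys ! l" "remove_nth l ys ! m = ys ! Suc m"
      using lm len by (simp_all add: nth_remove_nth)
    have comm: "partial (ys ! l) (partial (ys ! Suc m) \<phi>) = partial (ys ! Suc m) (partial (ys ! l) \<phi>)"
      by (intro ext partial_commute) (use \<phi> in \<open>simp add: test_fun_def\<close>)
    have rem: "remove_nth m (remove_nth l ys) = remove_nth l (remove_nth (Suc m) ys)"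
      using lm len by (intro remove_nth_remove_nth) auto
    show "- F (case p of (m, l) \<Rightarrow> (l, m - 1)) = F p"
      unfolding p F_def by (simp add: nth comm rem add.commute[of l m])
  qed auto
  finally show "L2_ip M (component ys 0) \<phi> =
     - (\<Sum>m<Suc (Suc j). (-1) ^ m * L2_ip M (component (remove_nth m ys) t) (partial (ys ! m) \<phi>))"
    by (simp add: sum_negf component_simps L2_ip_def)
qed

end

section \<open>The open mapping theorem for closed linear relations\<close>

text \<open>Completeness is stated for absolutely summable series, the form in which both the Baire
  argument and the open mapping iteration use it. Limits need not be unique, as \<open>nm\<close>
  may vanish at nonzero elements.\<close>

locale complete_seminorm =
  fixes V :: "'a::real_vector set" and nm :: "'a \<Rightarrow> real"
  assumes V: "subspace V"
    and triangle: "\<And>x y. x \<in> V \<Longrightarrow> y \<in> V \<Longrightarrow> nm (x + y) \<le> nm x + nm y"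
    and scale: "\<And>r x. x \<in> V \<Longrightarrow> nm (r *\<^sub>R x) = \<bar>r\<bar> * nm x"
    and complete: "\<And>x. (\<And>n. x n \<in> V) \<Longrightarrow> summable (\<lambda>n. nm (x n)) \<Longrightarrow>
       \<exists>l\<in>V. (\<lambda>N. nm (l - (\<Sum>n<N. x n))) \<longlonglongrightarrow> 0"
begin

lemma closed: "x \<in> V \<Longrightarrow> y \<in> V \<Longrightarrow> x + y \<in> V" "x \<in> V \<Longrightarrow> y \<in> V \<Longrightarrow> x - y \<in> V"
  "x \<in> V \<Longrightarrow> r *\<^sub>R x \<in> V" "0 \<in> V" "(\<And>i. i \<in> I \<Longrightarrow> f i \<in> V) \<Longrightarrow> sum f I \<in> V"
  using V by (auto intro: subspace_add subspace_scale subspace_diff subspace_sum subspace_0)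

lemma zero: "nm 0 = 0"
  using scale[OF closed(4), of 0] by simp

lemma minus_commute: "x \<in> V \<Longrightarrow> y \<in> V \<Longrightarrow> nm (x - y) = nm (y - x)"
  using scale[OF closed(2), of y x "-1"] by simp

lemma nonneg: "x \<in> V \<Longrightarrow> nm x \<ge> 0"
  using triangle[of x "(-1) *\<^sub>R x"] scale[of x "-1"] zero closed(3)[of x "-1"] by simp

lemma triangle_diff: "x \<in> V \<Longrightarrow> y \<in> V \<Longrightarrow> nm (x - y) \<le> nm x + nm y"
  using triangle[of x "(-1) *\<^sub>R y"] scale[of y "-1"] closed(3)[of y "-1"] by simp

lemma triangle3: "x \<in> V \<Longrightarrow> y \<in> V \<Longrightarrow> z \<in> V \<Longrightarrow> nm (x - z) \<le> nm (x - y) + nm (y - z)"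
  using triangle[of "x - y" "y - z"] closed(2) by simp

lemma sum_le: "(\<And>i. i \<in> I \<Longrightarrow> f i \<in> V) \<Longrightarrow> nm (sum f I) \<le> (\<Sum>i\<in>I. nm (f i))"
proof (induction I rule: infinite_finite_induct)
  case (insert i I)
  then have "nm (f i + sum f I) \<le> nm (f i) + nm (sum f I)"
    by (intro triangle closed(5)) auto
  with insert show ?case by force
qed (auto simp: zero)

text \<open>Baire's theorem by nested balls: if no \<open>A m\<close> were dense in a ball, each
  ball would contain a smaller one at positive distance from the next set, and the limit of the
  centres would lie in none of them.\<close>

lemma baire_dense_in_ball:
  assumes cover: "\<And>z. z \<in> V \<Longrightarrow> \<exists>m::nat. z \<in> A m"
  shows "\<exists>m. \<exists>z0\<in>V. \<exists>r>0. \<forall>z\<in>V. nm (z - z0) < r \<longrightarrow> (\<forall>\<epsilon>>0. \<exists>a\<in>A m \<inter> V. nm (z - a) < \<epsilon>)"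
proof (rule ccontr)
  assume neg: "\<not> ?thesis"
  have far: "\<exists>z\<in>V. nm (z - z0) < r \<and> (\<exists>\<epsilon>>0. \<forall>a\<in>A m \<inter> V. nm (z - a) \<ge> \<epsilon>)"
    if "z0 \<in> V" "r > 0" for m z0 r
  proof (rule ccontr)
    assume "\<not> ?thesis"
    then have "\<forall>z\<in>V. nm (z - z0) < r \<longrightarrow> (\<forall>\<epsilon>>0. \<exists>a\<in>A m \<inter> V. nm (z - a) < \<epsilon>)"
      by (meson not_le)
    with neg that show False by blast
  qed
  define P where "P = (\<lambda>(z, r). z \<in> V \<and> r > (0::real))"
  \<comment> \<open>The new centre keeps distance \<open>2 * r'\<close> from \<open>A n\<close>,
    while the limit will lie within \<open>r'\<close> of that centre. Halving the radii makes the
    steps summable.\<close>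
  define Q where "Q = (\<lambda>n (z, r) (z', r'). nm (z' - z) < r / 2 \<and> r' \<le> r / 2 \<and>
    (\<forall>a\<in>A n \<inter> V. nm (z' - a) \<ge> 2 * r'))"
  have step: "\<exists>y. P y \<and> Q n x y" if Px: "P x" for x n
  proof -
    obtain z r where x: "x = (z, r)" by force
    then have zr: "z \<in> V" "r > 0" using Px by (auto simp: P_def)
    then have "r / 2 > 0" by simp
    from far[OF zr(1) this, of n] obtain z' \<epsilon> where z': "z' \<in> V" "nm (z' - z) < r / 2" "\<epsilon> > 0"
      "\<forall>a\<in>A n \<inter> V. nm (z' - a) \<ge> \<epsilon>"
      by blast
    define r' where "r' = min (r / 2) (\<epsilon> / 2)"
    have r': "r' > 0" "r' \<le> r / 2" "2 * r' \<le> \<epsilon>" using zr z' by (auto simp: r'_def)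
    then have "\<forall>a\<in>A n \<inter> V. nm (z' - a) \<ge> 2 * r'" using z'(4) by force
    with r' z' have "P (z', r') \<and> Q n x (z', r')" by (simp add: P_def Q_def x)
    then show ?thesis by blast
  qed
  have "P (0, 1)" by (simp add: P_def closed(4))
  then have "\<exists>x. P x" by blast
  from dependent_nat_choice[of "\<lambda>_. P" Q, OF this step]
  obtain f where f: "\<And>n. P (f n)" "\<And>n. Q n (f n) (f (Suc n))" by blast
  define z where "z n = fst (f n)" for n
  define r where "r n = snd (f n)" for n
  have z: "z n \<in> V" and r: "r n > 0" for n
    using f(1)[of n] by (simp_all add: P_def z_def r_def case_prod_beta)
  have Q: "nm (z (Suc n) - z n) < r n / 2" "r (Suc n) \<le> r n / 2"
    "\<And>a. a \<in> A n \<inter> V \<Longrightarrow> nm (z (Suc n) - a) \<ge> 2 * r (Suc n)" for n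
    using f(2)[of n] by (simp_all add: Q_def z_def r_def case_prod_beta)
  have r_le: "r n \<le> r 0 * (1 / 2) ^ n" for n
  proof (induction n)
    case (Suc n)
    then show ?case using Q(2)[of n] by simp
  qed simp
  have "summable (\<lambda>n. nm (z (Suc n) - z n))"
  proof (rule summable_comparison_test')
    show "summable (\<lambda>n. r 0 * (1 / 2) ^ n)" by (intro summable_mult summable_geometric) simp
    show "norm (nm (z (Suc n) - z n)) \<le> r 0 * (1 / 2) ^ n" for n
      using nonneg[OF closed(2)[OF z z], of "Suc n" n] Q(1)[of n] r[of n] r_le[of n] by simp
  qed
  then obtain l where l: "l \<in> V" "(\<lambda>N. nm (l - (\<Sum>n<N. z (Suc n) - z n))) \<longlonglongrightarrow> 0"
    using complete[of "\<lambda>n. z (Suc n) - z n"] closed(2)[OF z z] by blast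
  define \<zeta> where "\<zeta> = z 0 + l"
  have \<zeta>: "\<zeta> \<in> V" unfolding \<zeta>_def by (intro closed z l)
  have "l - (\<Sum>n<N. z (Suc n) - z n) = \<zeta> - z N" for N
    by (simp add: sum_lessThan_telescope \<zeta>_def)
  with l(2) have lim: "(\<lambda>N. nm (\<zeta> - z N)) \<longlonglongrightarrow> 0" by simp
  \<comment> \<open>This telescopes because each step is shorter than half the current radius, and
    the radius drops by at least that half.\<close>
  have dist: "nm (z (N + k) - z N) \<le> r N - r (N + k)" for N k
  proof (induction k)
    case (Suc k)
    have "nm (z (N + Suc k) - z N) \<le> nm (z (N + Suc k) - z (N + k)) + nm (z (N + k) - z N)"
      by (rule triangle3[OF z z z])
    with Suc Q(1,2)[of "N + k"] show ?case by simp
  qed (simp add: zero)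
  have near: "nm (\<zeta> - z N) \<le> r N" for N
  proof (rule LIMSEQ_le_const)
    show "(\<lambda>k. nm (\<zeta> - z (k + N)) + r N) \<longlonglongrightarrow> r N"
      using tendsto_add[OF LIMSEQ_ignore_initial_segment[OF lim, of N] tendsto_const[of "r N"]] by simp
    have "nm (\<zeta> - z N) \<le> nm (\<zeta> - z (k + N)) + r N" for k
      using triangle3[OF \<zeta> z[of "k + N"] z[of N]] dist[of N k] r[of "N + k"] by (simp add: add.commute)
    then show "\<exists>K. \<forall>k\<ge>K. nm (\<zeta> - z N) \<le> nm (\<zeta> - z (k + N)) + r N" by blast
  qed
  obtain m where "\<zeta> \<in> A m" using cover[OF \<zeta>] by blast
  with Q(3)[of \<zeta> m] \<zeta> have "nm (z (Suc m) - \<zeta>) \<ge> 2 * r (Suc m)" by simp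
  with near[of "Suc m"] r[of "Suc m"] minus_commute[OF \<zeta> z, of "Suc m"] show False by simp
qed

end

text \<open>A relation rather than a map, since d is defined on part of \<open>X\<close> only and
  its values are fixed only up to null sets. Baire gives a ball in which elements with bounded
  preimages are dense; subtracting and rescaling yields approximate preimages near 0, and iterating
  on the error makes them exact by closedness.\<close>

lemma open_mapping_relation:
  fixes R :: "'a::real_vector \<Rightarrow> 'b::real_vector \<Rightarrow> bool"
  assumes "complete_seminorm X q" "complete_seminorm Z p"
    and R: "\<And>s z. R s z \<Longrightarrow> s \<in> X \<and> z \<in> Z"
    and R_add: "\<And>s z s' z'. R s z \<Longrightarrow> R s' z' \<Longrightarrow> R (s + s') (z + z')"
    and R_scale: "\<And>s z c. R s z \<Longrightarrow> R (c *\<^sub>R s) (c *\<^sub>R z)"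
    and R_zero: "R 0 0"
    and R_closed: "\<And>S T s z. (\<And>n. R (S n) (T n)) \<Longrightarrow> s \<in> X \<Longrightarrow> z \<in> Z \<Longrightarrow>
       (\<lambda>n. q (s - S n)) \<longlonglongrightarrow> 0 \<Longrightarrow> (\<lambda>n. p (z - T n)) \<longlonglongrightarrow> 0 \<Longrightarrow> R s z"
    and surj: "\<And>z. z \<in> Z \<Longrightarrow> \<exists>s. R s z"
  shows "\<exists>c>0. \<forall>z\<in>Z. \<exists>s. R s z \<and> q s \<le> c * p z"
proof -
  interpret X: complete_seminorm X q by fact
  interpret Z: complete_seminorm Z p by fact
  define A where "A m = {a. \<exists>s. R s a \<and> q s \<le> real m}" for m
  have "\<exists>m. z \<in> A m" if "z \<in> Z" for z
    using surj[OF that] real_arch_simple unfolding A_def by blast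
  from Z.baire_dense_in_ball[of A, OF this] obtain m z0 r where z0: "z0 \<in> Z" and r: "r > 0"
    and dense: "\<And>z \<epsilon>. z \<in> Z \<Longrightarrow> p (z - z0) < r \<Longrightarrow> \<epsilon> > 0 \<Longrightarrow> \<exists>a\<in>A m \<inter> Z. p (z - a) < \<epsilon>"
    by blast
  \<comment> \<open>Density holds around \<open>z0\<close>, not around 0: subtracting an
    approximation of \<open>z0\<close> costs two preimages of size at most \<open>m\<close>, and
    rescaling radius \<open>r\<close> to \<open>\<delta>\<close> contributes the factor
    \<open>\<delta> / r\<close>.\<close>
  define K where "K = 2 * real m / r"
  have K: "K \<ge> 0" using r by (simp add: K_def)
  have approx: "\<exists>s a. R s a \<and> q s \<le> K * \<delta> \<and> p (z - a) < \<epsilon>"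
    if z: "z \<in> Z" "p z < \<delta>" and e: "\<epsilon> > 0" for z \<delta> \<epsilon>
  proof -
    have \<delta>: "\<delta> > 0" using Z.nonneg[OF z(1)] z(2) by simp
    define t where "t = r / \<delta>"
    have t: "t > 0" using r \<delta> by (simp add: t_def)
    define y where "y = z0 + t *\<^sub>R z"
    have y: "y \<in> Z" unfolding y_def by (intro Z.closed z0 z)
    have "p (y - z0) = t * p z" using t z by (simp add: y_def Z.scale)
    also have "\<dots> < t * \<delta>" using t z by simp
    also have "t * \<delta> = r" using \<delta> by (simp add: t_def)
    finally have "p (y - z0) < r" .
    from dense[OF y this, of "t * \<epsilon> / 2"] t e obtain a1 where "a1 \<in> A m" "p (y - a1) < t * \<epsilon> / 2" by auto
    then obtain s1 where 1: "R s1 a1" "q s1 \<le> real m" "p (y - a1) < t * \<epsilon> / 2" by (auto simp: A_def)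
    from dense[OF z0, of "t * \<epsilon> / 2"] t e r obtain a2 where "a2 \<in> A m" "p (z0 - a2) < t * \<epsilon> / 2"
      by (auto simp: Z.zero)
    then obtain s2 where 2: "R s2 a2" "q s2 \<le> real m" "p (z0 - a2) < t * \<epsilon> / 2" by (auto simp: A_def)
    let ?s = "(1 / t) *\<^sub>R (s1 + (-1) *\<^sub>R s2)" and ?a = "(1 / t) *\<^sub>R (a1 + (-1) *\<^sub>R a2)"
    have mem: "s1 \<in> X" "s2 \<in> X" "a1 \<in> Z" "a2 \<in> Z" using 1 2 R by auto
    have "R ?s ?a" by (intro R_scale R_add 1 2)
    moreover have "q ?s \<le> K * \<delta>"
    proof -
      have "q ?s = (1 / t) * q (s1 - s2)"
        using t mem by (simp add: X.scale X.closed)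
      also have "\<dots> \<le> (1 / t) * (2 * real m)"
        using X.triangle_diff[OF mem(1,2)] 1(2) 2(2) t by (intro mult_left_mono) auto
      also have "\<dots> = K * \<delta>" by (simp add: K_def t_def)
      finally show ?thesis .
    qed
    moreover have "p (z - ?a) < \<epsilon>"
    proof -
      have "z - ?a = (1 / t) *\<^sub>R ((y - a1) - (z0 - a2))"
        using t by (simp add: y_def algebra_simps)
      then have "p (z - ?a) = (1 / t) * p ((y - a1) - (z0 - a2))"
        using t mem y z0 by (simp add: Z.scale Z.closed)
      also have "\<dots> < (1 / t) * (t * \<epsilon>)"
        using Z.triangle_diff[OF Z.closed(2)[OF y mem(3)] Z.closed(2)[OF z0 mem(4)]] 1(3) 2(3) t
        by (intro mult_strict_left_mono) auto
      finally show ?thesis using t by simp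
    qed
    ultimately show ?thesis by blast
  qed
  have lift: "\<exists>s. R s z \<and> q s \<le> 2 * K * \<delta>" if z: "z \<in> Z" "p z < \<delta>" for z \<delta>
  proof -
    have \<delta>: "\<delta> > 0" using Z.nonneg[OF z(1)] z(2) by simp
    \<comment> \<open>Each step halves the bound on the error, so the preimages have total size at
      most \<open>K\<close> times the geometric sum \<open>2 * \<delta>\<close>.\<close>
    define d where "d n = \<delta> * (1 / 2) ^ n" for n :: nat
    have d: "d n > 0" for n using \<delta> by (simp add: d_def)
    have "\<exists>sa. y \<in> Z \<and> p y < d n \<longrightarrow> R (fst sa) (snd sa) \<and> q (fst sa) \<le> K * d n \<and> p (y - snd sa) < d (Suc n)" for y n
      using approx[of y "d n" "d (Suc n)"] d[of "Suc n"] by auto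
    then obtain F where F: "\<And>y n. y \<in> Z \<Longrightarrow> p y < d n \<Longrightarrow>
       R (fst (F y n)) (snd (F y n)) \<and> q (fst (F y n)) \<le> K * d n \<and> p (y - snd (F y n)) < d (Suc n)"
      by metis
    define y where "y = rec_nat z (\<lambda>n y. y - snd (F y n))"
    have y0: "y 0 = z" and ySuc: "y (Suc n) = y n - snd (F (y n) n)" for n
      by (simp_all add: y_def)
    have y: "y n \<in> Z \<and> p (y n) < d n" for n
    proof (induction n)
      case 0
      then show ?case using z by (simp add: y0 d_def)
    next
      case (Suc n)
      with F[of "y n" n] R show ?case by (auto simp: ySuc intro: Z.closed)
    qed
    define s where "s n = fst (F (y n) n)" for n
    define a where "a n = snd (F (y n) n)" for n
    have sa: "R (s n) (a n)" "q (s n) \<le> K * d n" for n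
      using F[of "y n" n] y[of n] by (auto simp: s_def a_def)
    have sX: "s n \<in> X" and aZ: "a n \<in> Z" for n using sa(1) R by blast+
    have "(\<Sum>i<n. a i) = z - y n" for n
      by (induction n) (simp_all add: y0 ySuc a_def)
    then have rest: "z - (\<Sum>i<n. a i) = y n" for n by simp
    have d_lim: "d \<longlonglongrightarrow> 0"
      unfolding d_def by (intro tendsto_mult_right_zero LIMSEQ_power_zero) simp
    have z_lim: "(\<lambda>n. p (z - (\<Sum>i<n. a i))) \<longlonglongrightarrow> 0"
      unfolding rest
      by (rule tendsto_sandwich[OF _ _ tendsto_const d_lim])
        (use y Z.nonneg in \<open>auto intro!: always_eventually less_imp_le\<close>)
    have d_sums: "d sums (2 * \<delta>)"
      using sums_mult[OF geometric_sums[of "1 / 2 :: real"], of \<delta>] by (simp add: d_def[abs_def] mult.commute)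
    have "summable (\<lambda>n. q (s n))"
      by (rule summable_comparison_test'[OF summable_mult[OF sums_summable[OF d_sums], of K]])
        (use sa(2) X.nonneg[OF sX] in auto)
    then obtain l where l: "l \<in> X" "(\<lambda>n. q (l - (\<Sum>i<n. s i))) \<longlonglongrightarrow> 0"
      using X.complete[of s] sX by blast
    have "R (\<Sum>i<n. s i) (\<Sum>i<n. a i)" for n
      by (induction n) (auto intro: R_zero R_add sa)
    then have "R l z"
      using l(1) z(1) l(2) z_lim by (rule R_closed)
    moreover have "q l \<le> 2 * K * \<delta>"
    proof (rule LIMSEQ_le_const)
      show "(\<lambda>n. q (l - (\<Sum>i<n. s i)) + 2 * K * \<delta>) \<longlonglongrightarrow> 2 * K * \<delta>"
        using tendsto_add[OF l(2) tendsto_const[of "2 * K * \<delta>"]] by simp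
      have "q l \<le> q (l - (\<Sum>i<n. s i)) + 2 * K * \<delta>" for n
      proof -
        have S: "(\<Sum>i<n. s i) \<in> X" by (intro X.closed sX)
        have "q (\<Sum>i<n. s i) \<le> (\<Sum>i<n. q (s i))" by (rule X.sum_le) (rule sX)
        also have "\<dots> \<le> (\<Sum>i<n. K * d i)" by (intro sum_mono sa)
        also have "\<dots> = K * (\<Sum>i<n. d i)" by (simp add: sum_distrib_left)
        also have "\<dots> \<le> K * (2 * \<delta>)"
          using sum_le_suminf[OF sums_summable[OF d_sums], of "{..<n}"] d sums_unique[OF d_sums] K
          by (intro mult_left_mono) (auto simp: less_imp_le)
        finally show ?thesis
          using X.triangle[OF X.closed(2)[OF l(1) S] S] by simp
      qed
      then show "\<exists>N. \<forall>n\<ge>N. q l \<le> q (l - (\<Sum>i<n. s i)) + 2 * K * \<delta>" by blast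
    qed
    ultimately show ?thesis by blast
  qed
  \<comment> \<open>\<open>lift\<close> wants a strict bound, so it is used with twice the norm,
    whence \<open>4 * K\<close>; elements of norm 0 are related to 0 by closedness. Adding 1 makes
    the constant positive.\<close>
  have "\<exists>s. R s z \<and> q s \<le> (4 * K + 1) * p z" if z: "z \<in> Z" for z
  proof (cases "p z = 0")
    case True
    have "R 0 z"
      by (rule R_closed[of "\<lambda>_. 0" "\<lambda>_. 0"]) (use R_zero z True X.closed X.zero in auto)
    then show ?thesis using True X.zero by auto
  next
    case False
    then have pos: "p z > 0" using Z.nonneg[OF z] by simp
    from lift[OF z, of "2 * p z"] pos obtain s where "R s z" "q s \<le> 4 * K * p z" by auto
    then show ?thesis using pos by (intro exI[of _ s]) (auto simp: algebra_simps)
  qed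
  then show ?thesis using K by (intro exI[of _ "4 * K + 1"]) auto
qed

section \<open>The inf-sup condition\<close>

lemma alternating_form_repeated:
  assumes "alternating_form w" "\<not> distinct xs"
  shows "w x xs = 0"
proof -
  obtain i k where ik: "i < length xs" "k < length xs" "i \<noteq> k" "xs ! i = xs ! k"
    using assms(2) by (auto simp: distinct_conv_nth)
  then have "w x (xs[i := xs ! k, k := xs ! i]) = - w x xs"
    using assms(1) unfolding alternating_form_def by blast
  moreover have "xs[i := xs ! k, k := xs ! i] = xs"
    using ik by (metis list_update_id)
  ultimately show ?thesis by simp
qed

text \<open>Carrying \<open>a\<close> to the left across \<open>bs\<close> takes
  \<open>length bs\<close> adjacent transpositions, each costing a sign.\<close>

lemma alternating_form_move:
  assumes alt: "alternating_form w"
  shows "w x (as @ bs @ a # cs) = (-1) ^ length bs * w x (as @ a # bs @ cs)"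
proof (induction bs arbitrary: as)
  case (Cons b bs)
  have "w x (as @ (b # bs) @ a # cs) = (-1) ^ length bs * w x (as @ b # a # bs @ cs)"
    using Cons[of "as @ [b]"] by simp
  moreover have "w x ((as @ b # a # bs @ cs)[length as := (as @ b # a # bs @ cs) ! Suc (length as),
      Suc (length as) := (as @ b # a # bs @ cs) ! length as]) = - w x (as @ b # a # bs @ cs)"
    using alt unfolding alternating_form_def by (metis (no_types) length_append length_Cons less_add_Suc1 add_Suc_right n_not_Suc_n Suc_less_eq2)
  then have "w x (as @ a # b # bs @ cs) = - w x (as @ b # a # bs @ cs)"
    by (simp add: nth_append list_update_append)
  ultimately show ?case by simp
qed simp

lemma not_distinct_if_long: "length xs > CARD('n) \<Longrightarrow> \<not> distinct (xs :: 'n::finite list)"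
proof
  assume "length xs > CARD('n)" "distinct xs"
  moreover have "card (set xs) \<le> CARD('n)" by (rule card_mono) auto
  ultimately show False by (simp add: distinct_card)
qed

lemma remove_nth_not_distinct:
  assumes "i < length ys" "l < length ys" "i \<noteq> l" "ys ! i = ys ! l" "m < length ys" "m \<noteq> i" "m \<noteq> l"
  shows "\<not> distinct (remove_nth m ys)"
proof -
  define p where "p i = (if i < m then i else i - 1)" for i
  have p: "p q < length (remove_nth m ys)" "remove_nth m ys ! p q = ys ! q" if "q < length ys" "q \<noteq> m" for q
    using that assms(5) by (auto simp: p_def length_remove_nth nth_remove_nth)
  have "p i \<noteq> p l" using assms by (auto simp: p_def)
  with p assms show ?thesis by (metis distinct_conv_nth)
qed

text \<open>Pigeonhole: an index list longer than the dimension repeats an entry. In degree n + 1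
  this stands in for exactness, which the cohomology hypothesis asserts only up to degree n.\<close>

lemma L2_forms_eq_zero:
  fixes w :: "'n::finite form"
  assumes w: "w \<in> L2_forms j \<Omega>" and j: "CARD('n) < j"
  shows "w = 0"
proof (intro ext)
  fix x and xs :: "'n list"
  show "w x xs = 0 x xs"
    using w j not_distinct_if_long[of xs] alternating_form_repeated[of w xs x]
    by (cases "length xs = j") (auto simp: L2_forms_iff)
qed

text \<open>The witness is the wedge product of the first \<open>j\<close> coordinate differentials
  in some enumeration, written as a determinant so that alternation becomes the sign rule for
  swapping rows.\<close>

lemma exists_constant_form:
  assumes "j \<le> CARD('n::finite)"
  shows "\<exists>(A :: 'n list \<Rightarrow> real) xs. length xs = j \<and> A xs = 1 \<and> alternating_form (\<lambda>_. A) \<and>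
     (\<forall>xs. length xs \<noteq> j \<longrightarrow> A xs = 0)"
proof -
  obtain f where f: "bij_betw f (UNIV :: 'n set) {0..<CARD('n)}"
    using ex_bij_betw_finite_nat[of "UNIV :: 'n set"] by auto
  have inj: "inj f" and rng: "f r < CARD('n)" for r
    using f by (auto simp: bij_betw_def)
  define g where "g = inv f"
  have gf: "g (f r) = r" for r using inj by (simp add: g_def)
  have fg: "f (g i) = i" if "i < CARD('n)" for i
    using that f by (simp add: g_def bij_betw_def f_inv_into_f)
  define B :: "'n list \<Rightarrow> real^'n^'n" where
    "B xs = (\<chi> r. if f r < j then axis (xs ! f r) 1 else axis r 1)" for xs
  define A where "A xs = (if length xs = j then det (B xs) else 0)" for xs
  let ?xs = "map g [0..<j]"
  have "B ?xs = mat 1"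
    by (auto simp: B_def vec_eq_iff mat_def axis_def gf)
  then have "A ?xs = 1" by (simp add: A_def)
  moreover have "alternating_form (\<lambda>_. A)"
    unfolding alternating_form_def
  proof (intro allI impI)
    fix xs :: "'n list" and i k assume ik: "i < length xs \<and> k < length xs \<and> i \<noteq> k"
    show "A (xs[i := xs ! k, k := xs ! i]) = - A xs"
    proof (cases "length xs = j")
      case True
      let ?p = "Transposition.transpose (g i) (g k)"
      have lt: "i < j" "k < j" "i < CARD('n)" "k < CARD('n)" using ik True assms by auto
      have ne: "g i \<noteq> g k" using fg[OF lt(3)] fg[OF lt(4)] ik by metis
      have "B (xs[i := xs ! k, k := xs ! i]) $ r = B xs $ ?p r" for r
      proof -
        consider "r = g i" | "r = g k" | "r \<noteq> g i" "r \<noteq> g k" by blast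
        then show ?thesis
        proof cases
          case 3
          then have "f r \<noteq> i" "f r \<noteq> k" using gf by metis+
          with 3 show ?thesis by (simp add: B_def)
        qed (use ik True lt ne fg in \<open>auto simp: B_def\<close>)
      qed
      then have "B (xs[i := xs ! k, k := xs ! i]) = (\<chi> r. B xs $ ?p r)"
        by (simp add: vec_eq_iff)
      also have "det \<dots> = of_int (sign ?p) * det (B xs)"
        by (rule det_permute_rows) (simp add: permutes_swap_id)
      finally show ?thesis
        using True ne by (simp add: A_def sign_swap_id)
    qed (simp add: A_def)
  qed
  ultimately show ?thesis
    by (intro exI[of _ A] exI[of _ ?xs]) (auto simp: A_def)
qed

context bounded_open
begin

text \<open>The kernel of d, phrased by \<open>weak_d\<close> so that it is a subspace without any
  detour through the choice in \<open>dform\<close>.\<close>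

definition closed_forms :: "nat \<Rightarrow> 'n form set" where
  "closed_forms j = {z \<in> L2_forms j \<Omega>. weak_d j \<Omega> z 0}"

lemma subspace_closed_forms: "subspace (closed_forms j)"
proof (rule subspaceI)
  show "0 \<in> closed_forms j" by (simp add: closed_forms_def LF.closed_zero weak_d_zero)
  show "x + y \<in> closed_forms j" if "x \<in> closed_forms j" "y \<in> closed_forms j" for x y
    using that weak_d_add[of x j y 0 0] LF.closed_add[of x j \<Omega> y] by (auto simp: closed_forms_def LF.closed_zero)
  show "c *\<^sub>R x \<in> closed_forms j" if "x \<in> closed_forms j" for c x
    using that weak_d_scaleR[of x j 0 c] LF.closed_scaleR[of x j \<Omega> c] by (auto simp: closed_forms_def LF.closed_zero)
qed

lemma complete_L2_forms: "complete_seminorm (L2_forms j \<Omega>) (LF.nrm j \<Omega>)"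
  by unfold_locales (use subspace_L2_forms LF.nrm_triangle LF.nrm_scaleR L2_forms_series in blast)+

lemma complete_closed_forms: "complete_seminorm (closed_forms j) (LF.nrm j \<Omega>)"
proof
  fix z :: "nat \<Rightarrow> 'n form"
  assume z: "\<And>n. z n \<in> closed_forms j" and s: "summable (\<lambda>n. LF.nrm j \<Omega> (z n))"
  have zL: "z n \<in> L2_forms j \<Omega>" for n using z by (simp add: closed_forms_def)
  obtain w where w: "w \<in> L2_forms j \<Omega>" "(\<lambda>N. LF.nrm j \<Omega> (w - (\<Sum>n<N. z n))) \<longlonglongrightarrow> 0"
    using L2_forms_series[OF zL s] by blast
  have S: "(\<Sum>n<N. z n) \<in> closed_forms j" for N
    by (intro subspace_sum subspace_closed_forms z)
  have "weak_d j \<Omega> w 0"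
    by (rule weak_d_closed[of "\<lambda>N. \<Sum>n<N. z n" j w "\<lambda>_. 0"])
      (use S w in \<open>auto simp: closed_forms_def LF.closed_zero LF.nrm_zero\<close>)
  with w show "\<exists>l\<in>closed_forms j. (\<lambda>N. LF.nrm j \<Omega> (l - (\<Sum>n<N. z n))) \<longlonglongrightarrow> 0"
    by (auto simp: closed_forms_def)
qed (use subspace_closed_forms LF.nrm_triangle LF.nrm_scaleR in \<open>auto simp: closed_forms_def\<close>)

lemma HLambda_iff: "w \<in> HLambda j \<Omega> \<longleftrightarrow> w \<in> L2_forms j \<Omega> \<and> (\<exists>t\<in>L2_forms (Suc j) \<Omega>. weak_d j \<Omega> w t)"
  by (auto simp: HLambda_def L2_forms_def)

lemma dform_weak_d:
  assumes "w \<in> HLambda j \<Omega>"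
  shows "dform j \<Omega> w \<in> L2_forms (Suc j) \<Omega>" "weak_d j \<Omega> w (dform j \<Omega> w)"
proof -
  have "\<exists>t. L2form (Suc j) \<Omega> t \<and> weak_d j \<Omega> w t"
    using assms by (auto simp: HLambda_def)
  from someI_ex[OF this] show "dform j \<Omega> w \<in> L2_forms (Suc j) \<Omega>" "weak_d j \<Omega> w (dform j \<Omega> w)"
    unfolding dform_def L2_forms_def by auto
qed

lemma dform_AE:
  assumes "w \<in> L2_forms j \<Omega>" "t \<in> L2_forms (Suc j) \<Omega>" "weak_d j \<Omega> w t"
  shows "AE x in M. dform j \<Omega> w x = t x"
  using dform_weak_d[of w j] assms HLambda_iff by (intro weak_d_unique[of _ j _ w]) auto

text \<open>Weak derivatives are unique up to null sets, so inner products do not see which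
  representative \<open>dform\<close> picks.\<close>

lemma form_inner_dform:
  assumes "w \<in> L2_forms j \<Omega>" "t \<in> L2_forms (Suc j) \<Omega>" "weak_d j \<Omega> w t" "v \<in> L2_forms (Suc j) \<Omega>"
  shows "form_inner (Suc j) \<Omega> (dform j \<Omega> w) v = form_inner (Suc j) \<Omega> t v"
  using dform_weak_d(1)[of w j] dform_AE[OF assms(1-3)] assms HLambda_iff
  by (intro form_inner_cong_AE) auto

lemma form_normsq_dform:
  assumes "w \<in> L2_forms j \<Omega>" "t \<in> L2_forms (Suc j) \<Omega>" "weak_d j \<Omega> w t"
  shows "form_normsq (Suc j) \<Omega> (dform j \<Omega> w) = (LF.nrm (Suc j) \<Omega> t)\<^sup>2"
proof -
  have d: "dform j \<Omega> w \<in> L2_forms (Suc j) \<Omega>"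
    using dform_weak_d(1)[of w j] assms HLambda_iff by blast
  show ?thesis
    unfolding form_normsq_def LF.nrm_power2[OF assms(2)]
    using form_inner_dform[OF assms d] form_inner_dform[OF assms assms(2)] LF.ip_commute[OF d assms(2)] by simp
qed

text \<open>The relation is the graph of d with the closed forms as target: landing in the target is
  d d = 0, and surjectivity is trivial cohomology.\<close>

lemma bounded_primitive:
  assumes coh: "trivial_cohomology \<Omega>" and j: "Suc j \<le> CARD('n)"
  shows "\<exists>c>0. \<forall>z\<in>closed_forms (Suc j). \<exists>s\<in>L2_forms j \<Omega>. weak_d j \<Omega> s z \<and>
    LF.nrm j \<Omega> s \<le> c * LF.nrm (Suc j) \<Omega> z"
proof -
  define R where "R s z \<longleftrightarrow> s \<in> L2_forms j \<Omega> \<and> z \<in> L2_forms (Suc j) \<Omega> \<and> weak_d j \<Omega> s z" for s z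
  have "\<exists>c>0. \<forall>z\<in>closed_forms (Suc j). \<exists>s. R s z \<and> LF.nrm j \<Omega> s \<le> c * LF.nrm (Suc j) \<Omega> z"
  proof (rule open_mapping_relation[OF complete_L2_forms complete_closed_forms])
    show "s \<in> L2_forms j \<Omega> \<and> z \<in> closed_forms (Suc j)" if "R s z" for s z
      using that weak_d_weak_d by (auto simp: R_def closed_forms_def)
    show "R (s + s') (z + z')" if "R s z" "R s' z'" for s z s' z'
      using that by (auto simp: R_def intro: LF.closed_add weak_d_add)
    show "R (c *\<^sub>R s) (c *\<^sub>R z)" if "R s z" for s z c
      using that by (auto simp: R_def intro: LF.closed_scaleR weak_d_scaleR)
    show "R 0 0" by (simp add: R_def LF.closed_zero weak_d_zero)
    show "R s z" if "\<And>n. R (S n) (T n)" "s \<in> L2_forms j \<Omega>" "z \<in> closed_forms (Suc j)"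
      "(\<lambda>n. LF.nrm j \<Omega> (s - S n)) \<longlonglongrightarrow> 0" "(\<lambda>n. LF.nrm (Suc j) \<Omega> (z - T n)) \<longlonglongrightarrow> 0" for S T s z
      using weak_d_closed[of S j s T z] that by (simp add: R_def closed_forms_def)
    show "\<exists>s. R s z" if z: "z \<in> closed_forms (Suc j)" for z
    proof -
      have zL: "z \<in> L2_forms (Suc j) \<Omega>" "weak_d (Suc j) \<Omega> z 0" using z by (auto simp: closed_forms_def)
      have "z \<in> HLambda (Suc j) \<Omega>" using zL LF.closed_zero by (auto simp: HLambda_iff)
      moreover have "AE x in M. dform (Suc j) \<Omega> z x = (\<lambda>_. 0)"
        using dform_AE[OF zL(1) LF.closed_zero zL(2)] by (simp add: zero_fun_def)
      ultimately obtain s where s: "s \<in> HLambda j \<Omega>" "AE x in M. z x = dform j \<Omega> s x"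
        using coh[unfolded trivial_cohomology_def, THEN conjunct2, THEN spec[of _ "Suc j"]] j by force
      \<comment> \<open>Exactness comes as an almost everywhere identity for \<open>dform\<close>;
        changing the representative turns it into an instance of the relation for \<open>z\<close>
        itself.\<close>
      have "AE x in M. dform j \<Omega> s x = z x" using s(2) by eventually_elim simp
      with weak_d_cong_AE[OF dform_weak_d(1)[OF s(1)] zL(1)] dform_weak_d(2)[OF s(1)]
      have "weak_d j \<Omega> s z" by blast
      then show ?thesis using s zL by (auto simp: R_def HLambda_iff)
    qed
  qed
  then show ?thesis unfolding R_def by blast
qed

text \<open>A Poincare inequality modulo the kernel: a weak derivative \<open>t\<close> is closed,
  so its bounded primitive serves. Once \<open>Suc j\<close> exceeds the dimension, \<open>t\<close>
  is 0 and so is the primitive.\<close>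

lemma bounded_lift:
  assumes coh: "trivial_cohomology \<Omega>"
  shows "\<exists>c>0. \<forall>u\<in>L2_forms j \<Omega>. \<forall>t\<in>L2_forms (Suc j) \<Omega>. weak_d j \<Omega> u t \<longrightarrow>
    (\<exists>s\<in>L2_forms j \<Omega>. weak_d j \<Omega> s t \<and> LF.nrm j \<Omega> s \<le> c * LF.nrm (Suc j) \<Omega> t)"
proof (cases "Suc j \<le> CARD('n)")
  case True
  then show ?thesis
  proof -
    obtain c where c: "c > 0" "\<And>z. z \<in> closed_forms (Suc j) \<Longrightarrow> \<exists>s\<in>L2_forms j \<Omega>. weak_d j \<Omega> s z \<and>
        LF.nrm j \<Omega> s \<le> c * LF.nrm (Suc j) \<Omega> z"
      using bounded_primitive[OF coh True] by blast
    have "t \<in> closed_forms (Suc j)" if "t \<in> L2_forms (Suc j) \<Omega>" "weak_d j \<Omega> u t" for t u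
      using that weak_d_weak_d by (simp add: closed_forms_def)
    with c show ?thesis by blast
  qed
next
  case False
  then have zero: "t = 0" if "t \<in> L2_forms (Suc j) \<Omega>" for t
    using L2_forms_eq_zero[OF that] by simp
  have "weak_d j \<Omega> 0 t \<and> LF.nrm j \<Omega> 0 \<le> 1 * LF.nrm (Suc j) \<Omega> t" if "t \<in> L2_forms (Suc j) \<Omega>" for t
    unfolding zero[OF that] by (simp add: weak_d_zero LF.nrm_zero)
  then show ?thesis
    using LF.closed_zero zero_less_one by blast
qed

text \<open>An index list of length \<open>Suc j\<close> repeats some entry. Omitting any other
  position leaves the repetition, so that term is 0; omitting one or the other of the two copies
  gives terms that cancel.\<close>

lemma weak_d_top:
  assumes w: "w \<in> L2_forms j \<Omega>" and j: "CARD('n) \<le> j"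
  shows "weak_d j \<Omega> w 0"
  unfolding weak_d_iff
proof (intro allI impI)
  fix \<phi> and ys :: "'n list" assume \<phi>: "test_fun \<Omega> \<phi>" and len: "length ys = Suc j"
  have alt: "alternating_form w" using w by (simp add: L2_forms_iff)
  have "\<not> distinct ys" using j len by (intro not_distinct_if_long) simp
  then obtain as bs cs a where ys: "ys = as @ [a] @ bs @ [a] @ cs"
    using not_distinct_decomp by blast
  define i where "i = length as"
  define l where "l = Suc (length as + length bs)"
  have il: "i < Suc j" "l < Suc j" "i \<noteq> l" "ys ! i = a" "ys ! l = a"
    using len by (auto simp: ys i_def l_def nth_append)
  define g where "g m = (-1) ^ m * L2_ip M (component (remove_nth m ys) w) (partial (ys ! m) \<phi>)" for m
  have "g m = 0" if "m \<in> {..<Suc j} - {i, l}" for m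
  proof -
    have "\<not> distinct (remove_nth m ys)"
      using that il len by (intro remove_nth_not_distinct[of i ys l]) auto
    then have "component (remove_nth m ys) w = (\<lambda>_. 0)"
      using alternating_form_repeated[OF alt] by blast
    then show ?thesis by (simp add: g_def L2_ip_def)
  qed
  then have "sum g {..<Suc j} = sum g {i, l}"
    using il by (intro sum.mono_neutral_right) auto
  also have "\<dots> = 0"
  proof -
    have "remove_nth i ys = as @ bs @ a # cs" "remove_nth l ys = as @ a # bs @ cs"
      by (simp_all add: remove_nth_def ys i_def l_def)
    \<comment> \<open>The two remaining lists differ by moving \<open>a\<close> across
      \<open>bs\<close>; as the omitted positions differ by \<open>length bs + 1\<close>, the total
      signs are opposite.\<close>
    then have "component (remove_nth i ys) w = (-1) ^ length bs *\<^sub>R component (remove_nth l ys) w"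
      using alternating_form_move[OF alt] by (simp add: fun_eq_iff)
    then have "L2_ip M (component (remove_nth i ys) w) (partial a \<phi>)
      = (-1) ^ length bs * L2_ip M (component (remove_nth l ys) w) (partial a \<phi>)"
      by (simp only: L2.ip_scaleR_left[OF L2_forms_component[OF w] test_fun_L2_fun[OF test_fun_partial[OF \<phi>]]])
    then show ?thesis
      using il by (simp add: g_def i_def l_def power_add)
  qed
  finally show "L2_ip M (component ys 0) \<phi> =
     - (\<Sum>m<Suc j. (-1) ^ m * L2_ip M (component (remove_nth m ys) w) (partial (ys ! m) \<phi>))"
    by (simp add: g_def L2_ip_def del: sum.lessThan_Suc)
qed

text \<open>A nonempty open set is not negligible, so a nonzero constant form has positive norm and
  can be normalised.\<close>

lemma exists_unit_form:
  assumes j: "j \<le> CARD('n)" and "\<Omega> \<noteq> {}"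
  shows "\<exists>w\<in>L2_forms j \<Omega>. LF.nrm j \<Omega> w = 1"
proof -
  obtain A :: "'n list \<Rightarrow> real" and xs where A: "length xs = j" "A xs = 1" "alternating_form (\<lambda>_. A)"
    "\<forall>xs. length xs \<noteq> j \<longrightarrow> A xs = 0"
    using exists_constant_form[OF j] by blast
  define w :: "'n form" where "w = (\<lambda>_. A)"
  have w: "w \<in> L2_forms j \<Omega>"
    using A finite_measure.integrable_const[OF finite_measure_M]
    by (auto simp: w_def L2_forms_iff L2_fun_def)
  have "LF.nrm j \<Omega> w \<noteq> 0"
  proof
    assume "LF.nrm j \<Omega> w = 0"
    then have "L2.nrm M (component xs w) \<le> 0"
      using component_nrm_le[OF w, of xs] by simp
    then have "measure M \<Omega> \<le> 0"
      using A(2) by (simp add: L2.nrm_def L2_ip_self w_def)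
    then have "measure lebesgue \<Omega> = 0"
      using open_domain by (simp add: measure_restrict_space measure_le_0_iff)
    then have "negligible \<Omega>"
      using lmeasurable_open[OF bounded_domain open_domain] negligible_iff_measure by blast
    then show False using open_not_negligible[OF open_domain] assms(2) by blast
  qed
  then show ?thesis
    using w LF.nrm_nonneg[OF w]
    by (intro bexI[of _ "(1 / LF.nrm j \<Omega> w) *\<^sub>R w"]) (auto simp: LF.nrm_scaleR LF.closed_scaleR)
qed


section \<open>Triples with explicit weak derivatives, and the inf-sup estimate\<close>

definition graph_triple :: "nat \<Rightarrow> 'n form \<Rightarrow> 'n form \<Rightarrow> 'n form \<Rightarrow> 'n form \<Rightarrow> 'n form \<Rightarrow> bool" where
  "graph_triple j \<sigma> s \<xi> u t \<longleftrightarrow>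
     \<sigma> \<in> L2_forms j \<Omega> \<and> s \<in> L2_forms (Suc j) \<Omega> \<and> weak_d j \<Omega> \<sigma> s \<and> \<xi> \<in> L2_forms (Suc (Suc j)) \<Omega> \<and>
     u \<in> L2_forms (Suc j) \<Omega> \<and> t \<in> L2_forms (Suc (Suc j)) \<Omega> \<and> weak_d (Suc j) \<Omega> u t"

definition graph_normsq :: "nat \<Rightarrow> 'n form \<Rightarrow> 'n form \<Rightarrow> 'n form \<Rightarrow> 'n form \<Rightarrow> 'n form \<Rightarrow> real" where
  "graph_normsq j \<sigma> s \<xi> u t = (LF.nrm j \<Omega> \<sigma>)\<^sup>2 + (LF.nrm (Suc j) \<Omega> s)\<^sup>2 + (LF.nrm (Suc (Suc j)) \<Omega> \<xi>)\<^sup>2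
     + (LF.nrm (Suc j) \<Omega> u)\<^sup>2 + (LF.nrm (Suc (Suc j)) \<Omega> t)\<^sup>2"

lemma graph_tripleD:
  assumes "graph_triple j \<sigma> s \<xi> u t"
  shows "\<sigma> \<in> L2_forms j \<Omega>" "s \<in> L2_forms (Suc j) \<Omega>" "weak_d j \<Omega> \<sigma> s" "\<xi> \<in> L2_forms (Suc (Suc j)) \<Omega>"
    "u \<in> L2_forms (Suc j) \<Omega>" "t \<in> L2_forms (Suc (Suc j)) \<Omega>" "weak_d (Suc j) \<Omega> u t"
  using assms by (simp_all add: graph_triple_def)

lemma graph_triple_scaleR:
  assumes "graph_triple j \<sigma> s \<xi> u t"
  shows "graph_triple j (r *\<^sub>R \<sigma>) (r *\<^sub>R s) (r *\<^sub>R \<xi>) (r *\<^sub>R u) (r *\<^sub>R t)"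
  using assms by (simp add: graph_triple_def LF.closed_scaleR weak_d_scaleR)

lemma graph_normsq_scaleR:
  assumes "graph_triple j \<sigma> s \<xi> u t"
  shows "graph_normsq j (r *\<^sub>R \<sigma>) (r *\<^sub>R s) (r *\<^sub>R \<xi>) (r *\<^sub>R u) (r *\<^sub>R t) = r\<^sup>2 * graph_normsq j \<sigma> s \<xi> u t"
  using graph_tripleD[OF assms]
  by (simp add: graph_normsq_def LF.nrm_scaleR power_mult_distrib distrib_left)

lemma unit_triples_iff:
  assumes "graph_triple j \<sigma> s \<xi> u t"
  shows "(\<sigma>, \<xi>, u) \<in> unit_triples (Suc j) \<Omega> \<longleftrightarrow> graph_normsq j \<sigma> s \<xi> u t = 1"
proof -
  note g = graph_tripleD[OF assms]
  have "\<sigma> \<in> HLambda j \<Omega>" "u \<in> HLambda (Suc j) \<Omega>" "L2form (Suc (Suc j)) \<Omega> \<xi>"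
    using g by (auto simp: HLambda_iff L2_forms_def)
  then show ?thesis
    using form_normsq_dform[OF g(1-3)] form_normsq_dform[OF g(5-7)] g
    by (simp add: unit_triples_def graph_normsq_def form_normsq_def LF.nrm_power2 add.assoc)
qed

lemma unit_triplesE:
  assumes "X \<in> unit_triples (Suc j) \<Omega>"
  obtains \<sigma> s \<xi> u t where "X = (\<sigma>, \<xi>, u)" "graph_triple j \<sigma> s \<xi> u t" "graph_normsq j \<sigma> s \<xi> u t = 1"
proof -
  obtain \<sigma> \<xi> u where X: "X = (\<sigma>, \<xi>, u)" by (cases X)
  have "\<sigma> \<in> HLambda j \<Omega>" "u \<in> HLambda (Suc j) \<Omega>" "L2form (Suc (Suc j)) \<Omega> \<xi>"
    using assms by (auto simp: unit_triples_def X)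
  then have "graph_triple j \<sigma> (dform j \<Omega> \<sigma>) \<xi> u (dform (Suc j) \<Omega> u)"
    using dform_weak_d by (auto simp: graph_triple_def HLambda_iff L2_forms_def)
  then show ?thesis
    using that[OF X] unit_triples_iff assms X by blast
qed

text \<open>Trades the derivatives chosen by \<open>dform\<close> for the representatives carried
  along in \<open>graph_triple\<close>, after which bilinearity is a plain computation.\<close>

lemma Bform_eq:
  assumes "graph_triple j \<sigma> s \<xi> u t" "graph_triple j \<tau> s' \<eta> v t'"
  shows "Bform (Suc j) \<Omega> (\<sigma>, \<xi>, u) (\<tau>, \<eta>, v) =
      form_inner j \<Omega> \<sigma> \<tau> + form_inner (Suc (Suc j)) \<Omega> \<xi> \<eta>
    + form_inner (Suc j) \<Omega> s v + form_inner (Suc (Suc j)) \<Omega> \<xi> t'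
    + form_inner (Suc j) \<Omega> s' u + form_inner (Suc (Suc j)) \<Omega> \<eta> t"
proof -
  note g = graph_tripleD[OF assms(1)] and g' = graph_tripleD[OF assms(2)]
  have d: "dform (Suc j) \<Omega> u \<in> L2_forms (Suc (Suc j)) \<Omega>" "dform (Suc j) \<Omega> v \<in> L2_forms (Suc (Suc j)) \<Omega>"
    using dform_weak_d(1) HLambda_iff g g' by blast+
  show ?thesis
    using form_inner_dform[OF g(1-3) g'(5)] form_inner_dform[OF g'(1-3) g(5)]
      form_inner_dform[OF g(5-7) g'(4)] form_inner_dform[OF g'(5-7) g(4)]
      LF.ip_commute[OF g(4) d(2)] LF.ip_commute[OF g'(4) d(1)] LF.ip_commute[OF g(4) g'(6)] LF.ip_commute[OF g'(4) g(6)]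
    by (simp add: Bform_def)
qed

lemma graph_nrm_le:
  assumes "graph_normsq j \<sigma> s \<xi> u t \<le> N\<^sup>2" "N \<ge> 0"
  shows "LF.nrm j \<Omega> \<sigma> \<le> N" "LF.nrm (Suc j) \<Omega> s \<le> N" "LF.nrm (Suc (Suc j)) \<Omega> \<xi> \<le> N"
    "LF.nrm (Suc j) \<Omega> u \<le> N" "LF.nrm (Suc (Suc j)) \<Omega> t \<le> N"
proof -
  have nn: "0 \<le> (LF.nrm i \<Omega> w)\<^sup>2" for i w by simp
  note n = nn[of j \<sigma>] nn[of "Suc j" s] nn[of "Suc (Suc j)" \<xi>] nn[of "Suc j" u] nn[of "Suc (Suc j)" t]
  show "LF.nrm j \<Omega> \<sigma> \<le> N" "LF.nrm (Suc j) \<Omega> s \<le> N" "LF.nrm (Suc (Suc j)) \<Omega> \<xi> \<le> N"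
    "LF.nrm (Suc j) \<Omega> u \<le> N" "LF.nrm (Suc (Suc j)) \<Omega> t \<le> N"
    by (rule power2_le_imp_le[OF _ assms(2)]; use assms(1) n in \<open>unfold graph_normsq_def, linarith\<close>)+
qed

text \<open>Six inner products, each at most \<open>1 * N\<close> by Cauchy-Schwarz. The bound makes
  the supremum finite and also shows that a triple with a positive value of \<open>Bform\<close> has
  nonzero norm.\<close>

lemma Bform_bound:
  assumes X: "graph_triple j \<sigma> s \<xi> u t" "graph_normsq j \<sigma> s \<xi> u t = 1"
    and Y: "graph_triple j \<tau> s' \<eta> v t'" "graph_normsq j \<tau> s' \<eta> v t' \<le> N\<^sup>2" "N \<ge> 0"
  shows "Bform (Suc j) \<Omega> (\<sigma>, \<xi>, u) (\<tau>, \<eta>, v) \<le> 6 * N"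
proof -
  note g = graph_tripleD[OF X(1)] and g' = graph_tripleD[OF Y(1)]
  have "graph_normsq j \<sigma> s \<xi> u t \<le> 1\<^sup>2" using X(2) by simp
  note n = graph_nrm_le[OF this zero_le_one] and n' = graph_nrm_le[OF Y(2,3)]
  have le: "form_inner i \<Omega> w z \<le> N"
    if "w \<in> L2_forms i \<Omega>" "z \<in> L2_forms i \<Omega>" "LF.nrm i \<Omega> w \<le> 1" "LF.nrm i \<Omega> z \<le> N" for i w z
  proof -
    have "form_inner i \<Omega> w z \<le> LF.nrm i \<Omega> w * LF.nrm i \<Omega> z"
      using LF.cauchy_schwarz[OF that(1,2)] by simp
    also have "\<dots> \<le> 1 * N" using that Y(3) LF.nrm_nonneg by (intro mult_mono) auto
    finally show ?thesis by simp
  qed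
  show ?thesis
    unfolding Bform_eq[OF X(1) Y(1)]
    using le[OF g(1) g'(1) n(1) n'(1)] le[OF g(4) g'(4) n(3) n'(3)] le[OF g(2) g'(5) n(2) n'(4)]
      le[OF g(4) g'(6) n(3) n'(5)] le[OF g(5) g'(2) n(4) n'(2)] le[OF g(6) g'(4) n(5) n'(3)]
      LF.ip_commute[OF g(5) g'(2)] LF.ip_commute[OF g(6) g'(4)]
    by linarith
qed

lemma bdd_above_Bform:
  assumes "X \<in> unit_triples (Suc j) \<Omega>"
  shows "bdd_above (Bform (Suc j) \<Omega> X ` unit_triples (Suc j) \<Omega>)"
proof (rule bdd_aboveI2)
  fix Y assume Y: "Y \<in> unit_triples (Suc j) \<Omega>"
  obtain \<sigma> s \<xi> u t where X: "X = (\<sigma>, \<xi>, u)" "graph_triple j \<sigma> s \<xi> u t" "graph_normsq j \<sigma> s \<xi> u t = 1"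
    using unit_triplesE[OF assms] .
  obtain \<tau> s' \<eta> v t' where Y: "Y = (\<tau>, \<eta>, v)" "graph_triple j \<tau> s' \<eta> v t'" "graph_normsq j \<tau> s' \<eta> v t' = 1"
    using unit_triplesE[OF Y] .
  show "Bform (Suc j) \<Omega> X Y \<le> 6"
    using Bform_bound[OF X(2,3) Y(2), of 1] Y(3) X(1) Y(1) by simp
qed

text \<open>A real infimum over the empty set carries no information. Below top degree a unit form
  in the second slot suffices; for \<open>Suc j = n\<close> that slot contains only 0, and a top
  degree form with derivative 0 fills the last slot.\<close>

lemma unit_triples_nonempty:
  assumes "Suc j \<le> CARD('n)" "\<Omega> \<noteq> {}"
  shows "unit_triples (Suc j) \<Omega> \<noteq> {}"
proof (cases "Suc (Suc j) \<le> CARD('n)")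
  case True
  obtain w where w: "w \<in> L2_forms (Suc (Suc j)) \<Omega>" "LF.nrm (Suc (Suc j)) \<Omega> w = 1"
    using exists_unit_form[OF True assms(2)] by blast
  have "graph_triple j 0 0 w 0 0"
    using w by (simp add: graph_triple_def LF.closed_zero weak_d_zero)
  moreover have "graph_normsq j 0 0 w 0 0 = 1"
    using w by (simp add: graph_normsq_def LF.nrm_zero)
  ultimately show ?thesis using unit_triples_iff by blast
next
  case False
  obtain w where w: "w \<in> L2_forms (Suc j) \<Omega>" "LF.nrm (Suc j) \<Omega> w = 1"
    using exists_unit_form[OF assms] by blast
  have "graph_triple j 0 0 0 w 0"
    using w weak_d_top[OF w(1)] False by (simp add: graph_triple_def LF.closed_zero weak_d_zero)
  moreover have "graph_normsq j 0 0 0 w 0 = 1"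
    using w by (simp add: graph_normsq_def LF.nrm_zero)
  ultimately show ?thesis using unit_triples_iff by blast
qed

text \<open>In the test triple \<open>t\<close> produces the norm of du, \<open>s\<close> in the
  last slot that of d \<sigma>, and \<open>e *\<^sub>R \<rho>\<close> that of the closed part of
  \<open>u\<close>; the lifting bound then recovers \<open>u\<close> itself.\<close>

lemma exists_good_test_triple:
  assumes X: "graph_triple j \<sigma> s \<xi> u t" "graph_normsq j \<sigma> s \<xi> u t = 1" and c: "c > 0"
    and lift: "\<exists>u'\<in>L2_forms (Suc j) \<Omega>. weak_d (Suc j) \<Omega> u' t \<and> LF.nrm (Suc j) \<Omega> u' \<le> c * LF.nrm (Suc (Suc j)) \<Omega> t"
    and prim: "\<And>z. z \<in> closed_forms (Suc j) \<Longrightarrow>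
      \<exists>\<rho>\<in>L2_forms j \<Omega>. weak_d j \<Omega> \<rho> z \<and> LF.nrm j \<Omega> \<rho> \<le> c * LF.nrm (Suc j) \<Omega> z"
  shows "\<exists>\<tau> s' \<eta> v t'. graph_triple j \<tau> s' \<eta> v t' \<and> graph_normsq j \<tau> s' \<eta> v t' \<le> 5 * (2 + c + c\<^sup>2)\<^sup>2 \<and>
    Bform (Suc j) \<Omega> (\<sigma>, \<xi>, u) (\<tau>, \<eta>, v) \<ge> 1 / (16 * (c\<^sup>2 + 1))"
proof -
  note g = graph_tripleD[OF X(1)]
  obtain u' where u': "u' \<in> L2_forms (Suc j) \<Omega>" "weak_d (Suc j) \<Omega> u' t"
    "LF.nrm (Suc j) \<Omega> u' \<le> c * LF.nrm (Suc (Suc j)) \<Omega> t"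
    using lift by blast
  define z where "z = u - u'"
  have z: "z \<in> L2_forms (Suc j) \<Omega>" unfolding z_def by (intro LF.closed_diff g u')
  have "weak_d (Suc j) \<Omega> (u + (-1) *\<^sub>R u') (t + (-1) *\<^sub>R t)"
    by (intro weak_d_add weak_d_scaleR LF.closed_scaleR g u')
  then have zc: "z \<in> closed_forms (Suc j)" using z by (simp add: closed_forms_def z_def)
  obtain \<rho> where \<rho>: "\<rho> \<in> L2_forms j \<Omega>" "weak_d j \<Omega> \<rho> z" "LF.nrm j \<Omega> \<rho> \<le> c * LF.nrm (Suc j) \<Omega> z"
    using prim[OF zc] by blast
  \<comment> \<open>Small enough that \<open>e * c\<^sup>2 \<le> 1 / 4\<close>: the cross terms
    caused by \<open>\<rho>\<close> and \<open>u'\<close> can then be charged to quarters of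
    \<open>a\<^sup>2\<close> and \<open>D\<^sup>2\<close>.\<close>
  define e where "e = 1 / (4 * (c\<^sup>2 + 1))"
  have e: "0 < e" "e \<le> 1" "e * c\<^sup>2 \<le> 1 / 4"
    using zero_le_power2[of c] by (auto simp: e_def field_simps add_pos_nonneg)
  \<comment> \<open>Since \<open>s\<close> is itself a derivative, the last test component
    \<open>s - u\<close> has derivative \<open>- t\<close>.\<close>
  have s0: "weak_d (Suc j) \<Omega> s 0" using weak_d_weak_d[OF g(3)] .
  have "weak_d (Suc j) \<Omega> (s + (-1) *\<^sub>R u) (0 + (-1) *\<^sub>R t)"
    by (intro weak_d_add weak_d_scaleR LF.closed_scaleR LF.closed_zero g s0)
  moreover have "weak_d j \<Omega> (\<sigma> + e *\<^sub>R \<rho>) (s + e *\<^sub>R z)"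
    by (intro weak_d_add weak_d_scaleR LF.closed_scaleR g \<rho> z)
  ultimately have Y: "graph_triple j (\<sigma> + e *\<^sub>R \<rho>) (s + e *\<^sub>R z) (\<xi> + t) (s - u) ((-1) *\<^sub>R t)"
    unfolding graph_triple_def using g \<rho>(1) z LF.closed_scaleR[OF g(6), of "-1"]
    by (simp add: LF.closed_add LF.closed_diff LF.closed_scaleR)
  define a b p U D \<zeta> where "a = LF.nrm j \<Omega> \<sigma>" and "b = LF.nrm (Suc (Suc j)) \<Omega> \<xi>"
    and "p = LF.nrm (Suc j) \<Omega> s" and "U = LF.nrm (Suc j) \<Omega> u" and "D = LF.nrm (Suc (Suc j)) \<Omega> t"
    and "\<zeta> = LF.nrm (Suc j) \<Omega> z"
  note nn = LF.nrm_nonneg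
  have nonneg: "a \<ge> 0" "b \<ge> 0" "p \<ge> 0" "U \<ge> 0" "D \<ge> 0" "\<zeta> \<ge> 0"
    using g z by (simp_all add: nn a_def b_def p_def U_def D_def \<zeta>_def)
  have one: "a\<^sup>2 + p\<^sup>2 + b\<^sup>2 + U\<^sup>2 + D\<^sup>2 = 1"
    using X(2) by (simp add: graph_normsq_def a_def b_def p_def U_def D_def)
  have "graph_normsq j \<sigma> s \<xi> u t \<le> 1\<^sup>2" using X(2) by simp
  note le1 = graph_nrm_le[OF this zero_le_one, folded a_def b_def p_def U_def D_def]
  have u'D: "LF.nrm (Suc j) \<Omega> u' \<le> c * D" using u'(3) by (simp add: D_def)
  have U_le: "U \<le> \<zeta> + c * D"
    using LF.nrm_triangle[OF z u'(1)] u'D by (simp add: z_def U_def \<zeta>_def)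
  have \<zeta>_le: "\<zeta> \<le> 1 + c"
  proof -
    have "\<zeta> \<le> U + LF.nrm (Suc j) \<Omega> u'"
      using LF.nrm_triangle[OF g(5) LF.closed_scaleR[OF u'(1)], of "-1"] LF.nrm_scaleR[OF u'(1), of "-1"]
      by (simp add: z_def U_def \<zeta>_def)
    moreover have "c * D \<le> c * 1" using c le1(5) by (intro mult_left_mono) auto
    ultimately show ?thesis using u'D le1(4) by linarith
  qed
  have \<rho>\<zeta>: "LF.nrm j \<Omega> \<rho> \<le> c * \<zeta>" using \<rho>(3) by (simp add: \<zeta>_def)
  \<comment> \<open>The two pairings of \<open>s\<close> with \<open>u\<close> cancel because of the
    minus sign in \<open>s - u\<close>; of the three pairings of \<open>\<xi>\<close> with
    \<open>t\<close> exactly one survives.\<close>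
  have B: "Bform (Suc j) \<Omega> (\<sigma>, \<xi>, u) (\<sigma> + e *\<^sub>R \<rho>, \<xi> + t, s - u) =
     a\<^sup>2 + b\<^sup>2 + p\<^sup>2 + e * (form_inner j \<Omega> \<sigma> \<rho> + (\<zeta>\<^sup>2 + form_inner (Suc j) \<Omega> z u')) + (form_inner (Suc (Suc j)) \<Omega> \<xi> t + D\<^sup>2)"
  proof -
    have zu: "form_inner (Suc j) \<Omega> z u = \<zeta>\<^sup>2 + form_inner (Suc j) \<Omega> z u'"
      using LF.ip_add_right[OF z u'(1) z] z by (simp add: z_def \<zeta>_def LF.nrm_power2)
    show ?thesis
      unfolding Bform_eq[OF X(1) Y] a_def b_def p_def D_def
      using g \<rho>(1) z
      by (simp add: LF.nrm_power2 LF.ip_simps zu algebra_simps LF.ip_scaleR_right[of _ _ _ _ "-1", simplified])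
  qed
  have lower: "a\<^sup>2 + b\<^sup>2 + p\<^sup>2 + e * (form_inner j \<Omega> \<sigma> \<rho> + (\<zeta>\<^sup>2 + form_inner (Suc j) \<Omega> z u')) + (form_inner (Suc (Suc j)) \<Omega> \<xi> t + D\<^sup>2)
     \<ge> 1 / (16 * (c\<^sup>2 + 1))"
  proof -
    have "form_inner j \<Omega> \<sigma> \<rho> \<ge> - (a * (c * \<zeta>))"
      using LF.cauchy_schwarz[OF g(1) \<rho>(1)] mult_left_mono[OF \<rho>\<zeta> nonneg(1)] by (simp add: a_def)
    moreover have "form_inner (Suc j) \<Omega> z u' \<ge> - (\<zeta> * (c * D))"
      using LF.cauchy_schwarz[OF z u'(1)] mult_left_mono[OF u'D nonneg(6)] by (simp add: \<zeta>_def)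
    ultimately have "e * (form_inner j \<Omega> \<sigma> \<rho> + (\<zeta>\<^sup>2 + form_inner (Suc j) \<Omega> z u'))
        \<ge> e * (\<zeta>\<^sup>2 - a * (c * \<zeta>) - \<zeta> * (c * D))"
      using e(1) by (intro mult_left_mono) auto
    moreover have "e * (\<zeta>\<^sup>2 - a * (c * \<zeta>) - \<zeta> * (c * D)) \<ge> e * \<zeta>\<^sup>2 / 2 - a\<^sup>2 / 4 - D\<^sup>2 / 4"
    proof -
      \<comment> \<open>Young's inequality: each cross term uses a quarter of
        \<open>e * \<zeta>\<^sup>2\<close>, so half of it remains.\<close>
      have "0 \<le> e * (\<zeta> / 2 - c * a)\<^sup>2" "0 \<le> e * (\<zeta> / 2 - c * D)\<^sup>2" using e(1) by simp_all
      moreover have "e * c\<^sup>2 * a\<^sup>2 \<le> 1 / 4 * a\<^sup>2" "e * c\<^sup>2 * D\<^sup>2 \<le> 1 / 4 * D\<^sup>2"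
        using e(3) by (intro mult_right_mono; simp)+
      ultimately show ?thesis
        by (simp add: power2_eq_square algebra_simps)
    qed
    moreover have "form_inner (Suc (Suc j)) \<Omega> \<xi> t \<ge> - (b\<^sup>2 / 2) - D\<^sup>2 / 2"
      using LF.cauchy_schwarz[OF g(4,6)] sum_squares_bound[of b D] by (simp add: b_def D_def)
    \<comment> \<open>The remaining half of \<open>e * \<zeta>\<^sup>2\<close> pays for
      \<open>U\<close>; the weight e/4 absorbs the factor 2 from squaring a sum.\<close>
    moreover have "e / 4 * U\<^sup>2 \<le> e * \<zeta>\<^sup>2 / 2 + D\<^sup>2 / 8"
    proof -
      have "U\<^sup>2 \<le> (\<zeta> + c * D)\<^sup>2" using U_le nonneg by (intro power_mono) auto
      also have "\<dots> \<le> 2 * \<zeta>\<^sup>2 + 2 * (c * D)\<^sup>2"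
        using sum_squares_bound[of \<zeta> "c * D"] by (simp add: power2_sum)
      finally have "e / 4 * U\<^sup>2 \<le> e / 4 * (2 * \<zeta>\<^sup>2 + 2 * (c * D)\<^sup>2)"
        using e(1) by (intro mult_left_mono) auto
      also have "\<dots> = e * \<zeta>\<^sup>2 / 2 + e * c\<^sup>2 * D\<^sup>2 / 2"
        by (simp add: power_mult_distrib algebra_simps)
      also have "e * c\<^sup>2 * D\<^sup>2 \<le> 1 / 4 * D\<^sup>2" using e(3) by (intro mult_right_mono) auto
      finally show ?thesis by simp
    qed
    moreover have "e / 4 * (a\<^sup>2 + p\<^sup>2 + b\<^sup>2 + D\<^sup>2) \<le> 1 / 16 * (a\<^sup>2 + p\<^sup>2 + b\<^sup>2 + D\<^sup>2)"
    proof (rule mult_right_mono)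
      have "1 * 4 \<le> 4 * (c\<^sup>2 + 1)" by simp
      then show "e / 4 \<le> 1 / 16" unfolding e_def by (simp add: field_simps add_pos_nonneg)
    qed simp
    moreover have "e / 4 * (a\<^sup>2 + p\<^sup>2 + b\<^sup>2 + U\<^sup>2 + D\<^sup>2) = 1 / (16 * (c\<^sup>2 + 1))"
      unfolding one by (simp add: e_def)
    then have "e / 4 * (a\<^sup>2 + p\<^sup>2 + b\<^sup>2 + D\<^sup>2) + e / 4 * U\<^sup>2 = 1 / (16 * (c\<^sup>2 + 1))"
      by (simp add: algebra_simps)
    \<comment> \<open>The balance is linear in the squares: \<open>a\<^sup>2\<close> keeps 3/4,
      \<open>b\<^sup>2\<close> keeps 1/2, \<open>p\<^sup>2\<close> is untouched, and
      \<open>D\<^sup>2\<close> keeps 1/8 after its contribution to \<open>U\<close>; each exceeds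
      the required 1/16.\<close>
    moreover have "\<kappa> \<le> A + B + P + T1 + (F + Q)"
      if "T2 \<le> T1" "E - A / 4 - Q / 4 \<le> T2" "- (B / 2) - Q / 2 \<le> F" "V \<le> E + Q / 8"
        "W \<le> 1 / 16 * (A + P + B + Q)" "W + V = \<kappa>" "0 \<le> A" "0 \<le> B" "0 \<le> P" "0 \<le> Q"
      for A B P Q T1 T2 E F V W \<kappa> :: real
      using that by argo
    ultimately show ?thesis
      using zero_le_power2 by blast
  qed
  \<comment> \<open>A common bound for the five norms: \<open>1 + c + c\<^sup>2\<close> for the
    first, \<open>2 + c\<close> for its derivative, at most 2 for the others.\<close>
  define L where "L = 2 + c + c\<^sup>2"
  have upper: "graph_normsq j (\<sigma> + e *\<^sub>R \<rho>) (s + e *\<^sub>R z) (\<xi> + t) (s - u) ((-1) *\<^sub>R t) \<le> 5 * L\<^sup>2"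
  proof -
    have "c * \<zeta> \<le> c * (1 + c)" using c \<zeta>_le by (intro mult_left_mono) auto
    then have r1: "LF.nrm j \<Omega> \<rho> \<le> c + c\<^sup>2" using \<rho>\<zeta> by (simp add: power2_eq_square algebra_simps)
    have small: "e * LF.nrm i \<Omega> w \<le> LF.nrm i \<Omega> w" if "w \<in> L2_forms i \<Omega>" for i w
      using mult_right_mono[OF e(2) nn[OF that]] by simp
    have L: "2 + c \<le> L" by (simp add: L_def)
    have "LF.nrm j \<Omega> (\<sigma> + e *\<^sub>R \<rho>) \<le> L"
      using LF.nrm_triangle[OF g(1) LF.closed_scaleR[OF \<rho>(1)], of e] LF.nrm_scaleR[OF \<rho>(1), of e]
        small[OF \<rho>(1)] r1 e(1) le1(1) c unfolding L_def a_def by simp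
    moreover have "LF.nrm (Suc j) \<Omega> (s + e *\<^sub>R z) \<le> L"
      using LF.nrm_triangle[OF g(2) LF.closed_scaleR[OF z], of e] LF.nrm_scaleR[OF z, of e]
        small[OF z] \<zeta>_le e(1) le1(2) L unfolding p_def \<zeta>_def by simp
    moreover have "LF.nrm (Suc (Suc j)) \<Omega> (\<xi> + t) \<le> L"
      using LF.nrm_triangle[OF g(4,6)] le1(3,5) c L unfolding b_def D_def by linarith
    moreover have "LF.nrm (Suc j) \<Omega> (s - u) \<le> L"
      using LF.nrm_triangle[OF g(2) LF.closed_scaleR[OF g(5)], of "-1"] LF.nrm_scaleR[OF g(5), of "-1"]
        le1(2,4) c L unfolding p_def U_def by simp
    moreover have "LF.nrm (Suc (Suc j)) \<Omega> ((-1) *\<^sub>R t) \<le> L"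
      using LF.nrm_scaleR[OF g(6), of "-1"] le1(5) c L unfolding D_def by simp
    ultimately show ?thesis
      unfolding graph_normsq_def
      using graph_tripleD[OF Y] nn power_mono[of _ L 2] by (smt (verit, best))
  qed
  show ?thesis
    using Y upper B lower unfolding L_def by (metis (no_types, lifting))
qed

lemma inf_sup:
  assumes coh: "trivial_cohomology \<Omega>" and j: "Suc j \<le> CARD('n)" and ne: "\<Omega> \<noteq> {}"
  shows "\<exists>C>0. C \<le> (INF X\<in>unit_triples (Suc j) \<Omega>. SUP Y\<in>unit_triples (Suc j) \<Omega>. Bform (Suc j) \<Omega> X Y)"
proof -
  obtain c1 where c1: "c1 > 0" "\<And>z. z \<in> closed_forms (Suc j) \<Longrightarrow>
      \<exists>\<rho>\<in>L2_forms j \<Omega>. weak_d j \<Omega> \<rho> z \<and> LF.nrm j \<Omega> \<rho> \<le> c1 * LF.nrm (Suc j) \<Omega> z"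
    using bounded_primitive[OF coh j] by blast
  obtain c2 where c2: "c2 > 0" "\<And>u t. u \<in> L2_forms (Suc j) \<Omega> \<Longrightarrow> t \<in> L2_forms (Suc (Suc j)) \<Omega> \<Longrightarrow> weak_d (Suc j) \<Omega> u t \<Longrightarrow>
      \<exists>u'\<in>L2_forms (Suc j) \<Omega>. weak_d (Suc j) \<Omega> u' t \<and> LF.nrm (Suc j) \<Omega> u' \<le> c2 * LF.nrm (Suc (Suc j)) \<Omega> t"
    using bounded_lift[OF coh, of "Suc j"] by blast
  \<comment> \<open>The two constants belong to neighbouring degrees, k for the primitive of
    \<open>z\<close> and k + 1 for the lift of du.\<close>
  define c where "c = max c1 c2"
  have c: "c > 0" using c1 by (simp add: c_def)
  have mono: "c1 * LF.nrm i \<Omega> w \<le> c * LF.nrm i \<Omega> w" "c2 * LF.nrm i \<Omega> w \<le> c * LF.nrm i \<Omega> w" if "w \<in> L2_forms i \<Omega>" for i w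
    using LF.nrm_nonneg[OF that] by (auto simp: c_def intro: mult_right_mono)
  define \<kappa> where "\<kappa> = 1 / (16 * (c\<^sup>2 + 1))"
  \<comment> \<open>The test triple has squared norm at most 5 times the square of
    \<open>2 + c + c\<^sup>2\<close>; 3 is a convenient bound for sqrt 5.\<close>
  define K where "K = 3 * (2 + c + c\<^sup>2)"
  have \<kappa>: "\<kappa> > 0" by (simp add: \<kappa>_def add_nonneg_pos)
  have K: "K > 0" using c by (simp add: K_def add_pos_nonneg)
  have "\<kappa> / K \<le> (SUP Y\<in>unit_triples (Suc j) \<Omega>. Bform (Suc j) \<Omega> X Y)" if X: "X \<in> unit_triples (Suc j) \<Omega>" for X
  proof -
    obtain \<sigma> s \<xi> u t where X': "X = (\<sigma>, \<xi>, u)" "graph_triple j \<sigma> s \<xi> u t" "graph_normsq j \<sigma> s \<xi> u t = 1"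
      using unit_triplesE[OF X] .
    note g = graph_tripleD[OF X'(2)]
    have "\<exists>u'\<in>L2_forms (Suc j) \<Omega>. weak_d (Suc j) \<Omega> u' t \<and> LF.nrm (Suc j) \<Omega> u' \<le> c * LF.nrm (Suc (Suc j)) \<Omega> t"
      using c2(2)[OF g(5-7)] mono(2)[OF g(6)] order_trans by blast
    moreover have "\<exists>\<rho>\<in>L2_forms j \<Omega>. weak_d j \<Omega> \<rho> z \<and> LF.nrm j \<Omega> \<rho> \<le> c * LF.nrm (Suc j) \<Omega> z"
      if "z \<in> closed_forms (Suc j)" for z
    proof -
      have "z \<in> L2_forms (Suc j) \<Omega>" using that by (simp add: closed_forms_def)
      from c1(2)[OF that] mono(1)[OF this] order_trans show ?thesis by blast
    qed
    ultimately obtain \<tau> s' \<eta> v t' where Y: "graph_triple j \<tau> s' \<eta> v t'"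
      "graph_normsq j \<tau> s' \<eta> v t' \<le> 5 * (2 + c + c\<^sup>2)\<^sup>2" "Bform (Suc j) \<Omega> (\<sigma>, \<xi>, u) (\<tau>, \<eta>, v) \<ge> \<kappa>"
      using exists_good_test_triple[OF X'(2,3) c] unfolding \<kappa>_def by blast
    define N where "N = sqrt (graph_normsq j \<tau> s' \<eta> v t')"
    have N2: "N\<^sup>2 = graph_normsq j \<tau> s' \<eta> v t'" and N0: "N \<ge> 0"
      by (simp_all add: N_def graph_normsq_def)
    \<comment> \<open>The upper bound on \<open>Bform\<close> is used backwards: a value of at least
      \<open>\<kappa>\<close> forces \<open>N\<close> to be positive, so the test triple can be
      normalised.\<close>
    have "\<kappa> \<le> 6 * N"
      using Bform_bound[OF X'(2,3) Y(1) _ N0] N2 Y(3) by simp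
    then have N: "N > 0" using \<kappa> by simp
    have "N \<le> K"
    proof (rule power2_le_imp_le)
      have "5 * (2 + c + c\<^sup>2)\<^sup>2 \<le> 9 * (2 + c + c\<^sup>2)\<^sup>2" by simp
      then have "N\<^sup>2 \<le> 9 * (2 + c + c\<^sup>2)\<^sup>2" using N2 Y(2) by linarith
      then show "N\<^sup>2 \<le> K\<^sup>2" unfolding K_def power_mult_distrib by simp
    qed (use K in simp)
    define r where "r = 1 / N"
    let ?Y = "(r *\<^sub>R \<tau>, r *\<^sub>R \<eta>, r *\<^sub>R v)"
    have gY: "graph_triple j (r *\<^sub>R \<tau>) (r *\<^sub>R s') (r *\<^sub>R \<eta>) (r *\<^sub>R v) (r *\<^sub>R t')"
      using Y(1) by (rule graph_triple_scaleR)
    have "?Y \<in> unit_triples (Suc j) \<Omega>"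
      unfolding unit_triples_iff[OF gY] graph_normsq_scaleR[OF Y(1)] N2[symmetric]
      using N by (simp add: r_def power_divide)
    moreover have "Bform (Suc j) \<Omega> X ?Y = r * Bform (Suc j) \<Omega> (\<sigma>, \<xi>, u) (\<tau>, \<eta>, v)"
      unfolding X'(1) Bform_eq[OF X'(2) gY] Bform_eq[OF X'(2) Y(1)]
      using g graph_tripleD[OF Y(1)]
      by (simp add: LF.ip_scaleR_left LF.ip_scaleR_right distrib_left)
    moreover have "\<kappa> / K \<le> r * Bform (Suc j) \<Omega> (\<sigma>, \<xi>, u) (\<tau>, \<eta>, v)"
    proof -
      have "\<kappa> / K \<le> \<kappa> / N" using \<open>N \<le> K\<close> N \<kappa> by (intro divide_left_mono) auto
      also have "\<dots> \<le> r * Bform (Suc j) \<Omega> (\<sigma>, \<xi>, u) (\<tau>, \<eta>, v)"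
        using Y(3) N by (simp add: r_def divide_right_mono)
      finally show ?thesis .
    qed
    ultimately show ?thesis
      using cSUP_upper2[OF bdd_above_Bform[OF X]] by metis
  qed
  then have "\<kappa> / K \<le> (INF X\<in>unit_triples (Suc j) \<Omega>. SUP Y\<in>unit_triples (Suc j) \<Omega>. Bform (Suc j) \<Omega> X Y)"
    using unit_triples_nonempty[OF j ne] by (intro cINF_greatest)
  then show ?thesis using \<kappa> K by (intro exI[of _ "\<kappa> / K"]) auto
qed

end

theorem theorem4p1:
  fixes \<Omega> :: "(real^'n) set" and k :: nat
  assumes "lipschitz_polyhedron \<Omega>" and "trivial_cohomology \<Omega>"
    and "1 \<le> k" and "k \<le> CARD('n)"
  shows "\<exists>C>0. C \<le> (INF X\<in>unit_triples k \<Omega>. SUP Y\<in>unit_triples k \<Omega>. Bform k \<Omega> X Y)"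
proof -
  have dom: "open \<Omega>" "bounded \<Omega>" "\<Omega> \<noteq> {}"
    using assms(1) by (auto simp: lipschitz_polyhedron_def lipschitz_domain_def)
  then interpret bounded_open \<Omega> by unfold_locales
  \<comment> \<open>Writing \<open>k\<close> as a successor turns the truncated subtraction
    \<open>k - 1\<close> of the definitions into an honest degree.\<close>
  obtain j where k: "k = Suc j" using assms(3) by (cases k) auto
  show ?thesis
    using inf_sup[of j] assms(2,4) dom(3) unfolding k by blast
qed

end
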